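(* Let $n\ge 1$, $k\ge 0$ and $0\le j\le 2n-2$ be integers. The operator $\mathcal D_j$ of the $k$-Cauchy-Fueter complex is $\mathrm{SL}(n+1,\mathbb H)$-invariant: for every $g\in \mathrm{SL}(n+1,\mathbb H)$, with $g^{-1}=\begin{pmatrix}\mathbf a&\mathbf b\\ \mathbf c&\mathbf d\end{pmatrix}$, and every $f\in\Gamma(\mathbb H^n,\mathcal V_j)$, $$\mathcal D_j\big(\pi_j(g)f\big)=\pi_{j+1}(g)\,\mathcal D_jf$$ on $\{\mathbf q\in\mathbb H^n:\ \mathbf a+\mathbf b\mathbf q\neq 0\}$.
   Context: Points of $\mathbb H^n$ are column vectors $\mathbf q=(\mathbf q_1,\dots,\mathbf q_n)^t$, with $\mathbf q_{l+1}=x_{4l}+\mathbf i x_{4l+1}+\mathbf j x_{4l+2}+\mathbf k x_{4l+3}$, $l=0,\dots,n-1$. For a quaternionic $p\times m$ matrix, $\tau$ denotes the complex $2p\times 2m$ matrix obtained by replacing each entry $x_0+\mathbf i x_1+\mathbf j x_2+\mathbf k x_3$ by $\begin{pmatrix}x_0+\mathbf i x_1&-x_2-\mathbf i x_3\\ x_2-\mathbf i x_3&x_0-\mathbf i x_1\end{pmatrix}$; $\tau$ is multiplicative. $\mathrm{SL}(n+1,\mathbb H)$ is the group of quaternionic $(n+1)\times(n+1)$ matrices $g$ with $\det\tau(g)=1$. Indices: $A,B\in\{0,\dots,2n-1\}$, $A',B'\in\{0',1'\}$; in a complex matrix the upper index is the row and the lower index the column; repeated indices are summed. For $g\in\mathrm{SL}(n+1,\mathbb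 H)$ write $g^{-1}=\begin{pmatrix}\mathbf a&\mathbf b\\ \mathbf c&\mathbf d\end{pmatrix}$ with blocks of sizes $1\times1$, $1\times n$, $n\times 1$, $n\times n$, and for $\mathbf a+\mathbf b\mathbf q\ne0$ put $$g^{-1}.\mathbf q=(\mathbf c+\mathbf d\mathbf q)(\mathbf a+\mathbf b\mathbf q)^{-1},\quad J_1(g^{-1},\mathbf q)=\mathbf a+\mathbf b\mathbf q\in\mathbb H,\quad J_2(g^{-1},\mathbf q)=\mathbf d-(\mathbf c+\mathbf d\mathbf q)(\mathbf a+\mathbf b\mathbf q)^{-1}\mathbf b\in \mathrm{GL}(n,\mathbb H).$$ Spaces: $\mathcal V_j=\odot^{k-j}\mathbb C^2\otimes\wedge^j\mathbb C^{2n*}$ for $0\le j\le k$, and $\mathcal V_j=\odot^{j-k-1}\mathbb C^{2*}\otimes\wedge^{j+1}\mathbb C^{2n*}$ for $k+1\le j\le 2n-1$. $\Gamma(D,\mathcal V_j)$ is the space of smooth $\mathcal V_j$-valued functions on $D$. A $\mathcal V_j$-valued function is written as a polynomial in commuting variables $s_{0'},s_{1'}$ (a basis of $\mathbb C^2$) if $j\le k$, or $s^{0'},s^{1'}$ (a basis of $\mathbb C^{2*}$) if $j\ge k+1$, and anticommuting (Grassmannian) variables $\omega^0,\dots,\omega^{2n-1}$ (a basis of $\mathbb C^{2n*}$): $f=f^{\mathbf A'}_{\mathbf A}(\mathbf q)s_{\mathbf A'}\omega^{\mathbf A}$ or $f=f_{\mathbf A\mathbf A'}(\mathbf q)s^{\mathbf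 A'}\omega^{\mathbf A}$, where $s_{\mathbf A'}=s_{A_1'}\cdots s_{A_\sigma'}$, $s^{\mathbf A'}=s^{A'_1}\cdots s^{A'_\sigma}$, $\omega^{\mathbf A}=\omega^{A_1}\cdots\omega^{A_\tau}$. Actions: for $\mathbf p\in\mathbb H\setminus\{0\}$, $\mathbf p.s_{A'}=\tau(\mathbf p)^{B'}_{A'}s_{B'}$ and $\mathbf p.s^{A'}=\tau(\mathbf p)^{A'}_{B'}s^{B'}$; for $\mathbf m\in\mathrm{GL}(n,\mathbb H)$, $\mathbf m.\omega^A=\tau(\mathbf m)^A_B\omega^B$; these extend multiplicatively to monomials. Then $$[\pi_j(g)f](\mathbf q)=\frac{f^{\mathbf A'}_{\mathbf A}(g^{-1}.\mathbf q)}{|\mathbf a+\mathbf b\mathbf q|^{2(j+1)}}\,\big(J_1(g^{-1},\mathbf q)^{-1}.s_{\mathbf A'}\big)\big(J_2(g^{-1},\mathbf q).\omega^{\mathbf A}\big)\quad(j\le k),$$ $$[\pi_j(g)f](\mathbf q)=\frac{f_{\mathbf A\mathbf A'}(g^{-1}.\mathbf q)}{|\mathbf a+\mathbf b\mathbf q|^{2(j+1)}}\,\big(J_1(g^{-1},\mathbf q).s^{\mathbf A'}\big)\big(J_2(g^{-1},\mathbf q).\omega^{\mathbf A}\big)\quad(j\ge k+1).$$ Operators: with $\partial_{x_i}=\partial/\partial x_i$, for $l=0,\dots,n-1$, $$\nabla^{0'}_{2l}=\tfrac12(\partial_{x_{4l}}-\mathbf i\partial_{x_{4l+1}}),\ \nabla^{0'}_{2l+1}=\tfrac12(\partial_{x_{4l+2}}+\mathbf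 i\partial_{x_{4l+3}}),\ \nabla^{1'}_{2l}=\tfrac12(-\partial_{x_{4l+2}}+\mathbf i\partial_{x_{4l+3}}),\ \nabla^{1'}_{2l+1}=\tfrac12(\partial_{x_{4l}}+\mathbf i\partial_{x_{4l+1}}).$$ $d^{A'}f$ is obtained by applying $\nabla^{A'}_A$ to the coefficients of $f$ and multiplying by $\omega^A$ on the left of the Grassmannian monomials, summed over $A$: $d^{A'}(f_{\mathbf A}\omega^{\mathbf A})=\nabla^{A'}_Af_{\mathbf A}\,\omega^A\omega^{\mathbf A}$. With $\partial^{A'}=\partial/\partial s_{A'}$, the operator $\mathcal D_j:\Gamma(\cdot,\mathcal V_j)\to\Gamma(\cdot,\mathcal V_{j+1})$ is $\mathcal D_j=\tfrac12(\partial^{0'}d^{1'}-\partial^{1'}d^{0'})$ if $j<k$; $\mathcal D_k=\tfrac12(d^{0'}d^{1'}-d^{1'}d^{0'})=d^{0'}d^{1'}$; $\mathcal D_j=\tfrac12(s^{0'}d^{1'}-s^{1'}d^{0'})$ if $j>k$. *)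

theory Defs
  imports "HOL-Analysis.Analysis" "HOL-Library.Poly_Mapping"
begin

section \<open>Quaternions\<close>

datatype quat = Quat (q0: real) (q1: real) (q2: real) (q3: real)

lemma quat_eq_iff: "x = y \<longleftrightarrow> q0 x = q0 y \<and> q1 x = q1 y \<and> q2 x = q2 y \<and> q3 x = q3 y"
  by (cases x; cases y) simp

instantiation quat :: ring_1
begin
definition "0 = Quat 0 0 0 0"
definition "1 = Quat 1 0 0 0"
definition "x + y = Quat (q0 x + q0 y) (q1 x + q1 y) (q2 x + q2 y) (q3 x + q3 y)"
definition "- x = Quat (- q0 x) (- q1 x) (- q2 x) (- q3 x)"
definition "x - y = Quat (q0 x - q0 y) (q1 x - q1 y) (q2 x - q2 y) (q3 x - q3 y)"
definition "x * y = Quat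
   (q0 x * q0 y - q1 x * q1 y - q2 x * q2 y - q3 x * q3 y)
   (q0 x * q1 y + q1 x * q0 y + q2 x * q3 y - q3 x * q2 y)
   (q0 x * q2 y - q1 x * q3 y + q2 x * q0 y + q3 x * q1 y)
   (q0 x * q3 y + q1 x * q2 y - q2 x * q1 y + q3 x * q0 y)"
instance
  by standard
    (simp_all add: quat_eq_iff zero_quat_def one_quat_def plus_quat_def uminus_quat_def
      minus_quat_def times_quat_def algebra_simps)
end

lemma quat_sel_ring [simp]:
  "q0 0 = 0" "q1 0 = 0" "q2 0 = 0" "q3 0 = 0"
  "q0 1 = 1" "q1 1 = 0" "q2 1 = 0" "q3 1 = 0"
  "q0 (x + y) = q0 x + q0 y" "q1 (x + y) = q1 x + q1 y"
  "q2 (x + y) = q2 x + q2 y" "q3 (x + y) = q3 x + q3 y"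
  "q0 (- x) = - q0 x" "q1 (- x) = - q1 x" "q2 (- x) = - q2 x" "q3 (- x) = - q3 x"
  "q0 (x - y) = q0 x - q0 y" "q1 (x - y) = q1 x - q1 y"
  "q2 (x - y) = q2 x - q2 y" "q3 (x - y) = q3 x - q3 y"
  "q0 (x * y) = q0 x * q0 y - q1 x * q1 y - q2 x * q2 y - q3 x * q3 y"
  "q1 (x * y) = q0 x * q1 y + q1 x * q0 y + q2 x * q3 y - q3 x * q2 y"
  "q2 (x * y) = q0 x * q2 y - q1 x * q3 y + q2 x * q0 y + q3 x * q1 y"
  "q3 (x * y) = q0 x * q3 y + q1 x * q2 y - q2 x * q1 y + q3 x * q0 y"
  by (simp_all add: zero_quat_def one_quat_def plus_quat_def uminus_quat_def
      minus_quat_def times_quat_def)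

instantiation quat :: real_algebra_1
begin
definition "r *\<^sub>R x = Quat (r * q0 x) (r * q1 x) (r * q2 x) (r * q3 x)"
instance
  by standard (simp_all add: quat_eq_iff scaleR_quat_def algebra_simps)
end

lemma quat_sel_scaleR [simp]:
  "q0 (r *\<^sub>R x) = r * q0 x" "q1 (r *\<^sub>R x) = r * q1 x"
  "q2 (r *\<^sub>R x) = r * q2 x" "q3 (r *\<^sub>R x) = r * q3 x"
  by (simp_all add: scaleR_quat_def)

instantiation quat :: real_inner
begin
definition "inner x y = q0 x * q0 y + q1 x * q1 y + q2 x * q2 y + q3 x * q3 y" for x y :: quat
definition "norm x = sqrt (inner x x)" for x :: quat
definition "sgn x = x /\<^sub>R norm x" for x :: quat
definition "dist x y = norm (x - y)" for x y :: quat
definition "uniformity = (INF e\<in>{0<..}. principal {(x::quat, y). dist x y < e})"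
definition "open U \<longleftrightarrow> (\<forall>x\<in>U. eventually (\<lambda>(x', y). x' = x \<longrightarrow> y \<in> U) uniformity)"
  for U :: "quat set"
instance
proof
  fix x y z :: quat and r :: real and U :: "quat set"
  have "inner x x = (q0 x)\<^sup>2 + (q1 x)\<^sup>2 + (q2 x)\<^sup>2 + (q3 x)\<^sup>2"
    by (simp add: inner_quat_def power2_eq_square)
  then show "0 \<le> inner x x" and "inner x x = 0 \<longleftrightarrow> x = 0"
    by (simp_all add: quat_eq_iff add_nonneg_eq_0_iff)
  show "inner x y = inner y x" "inner (x + y) z = inner x z + inner y z"
    "inner (r *\<^sub>R x) y = r * inner x y"
    by (simp_all add: inner_quat_def algebra_simps)
qed (rule norm_quat_def sgn_quat_def dist_quat_def uniformity_quat_def open_quat_def)+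
end

instantiation quat :: real_normed_div_algebra
begin
definition "inverse x = inverse (inner x x) *\<^sub>R Quat (q0 x) (- q1 x) (- q2 x) (- q3 x)" for x :: quat
definition "x div y = x * inverse y" for x y :: quat
instance
proof
  fix x y :: quat
  let ?c = "Quat (q0 x) (- q1 x) (- q2 x) (- q3 x)"
  have *: "?c * x = inner x x *\<^sub>R 1" "x * ?c = inner x x *\<^sub>R 1"
    by (simp_all add: quat_eq_iff inner_quat_def)
  show "inverse x * x = 1" "x * inverse x = 1" if "x \<noteq> 0"
    using that * by (simp_all add: inverse_quat_def del: quat_sel_ring quat_sel_scaleR)
  have "inner (x * y) (x * y) = inner x x * inner y y"
    unfolding inner_quat_def quat_sel_ring by algebra
  then show "norm (x * y) = norm x * norm y"
    by (simp only: norm_quat_def real_sqrt_mult)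
  show "x div y = x * inverse y"
    by (simp only: divide_quat_def)
  show "inverse (0 :: quat) = 0"
    by (simp add: inverse_quat_def)
qed
end

definition qI :: quat where "qI = Quat 0 1 0 0"
definition qJ :: quat where "qJ = Quat 0 0 1 0"
definition qK :: quat where "qK = Quat 0 0 0 1"

lemma quat_sel_units [simp]:
  "q0 qI = 0" "q1 qI = 1" "q2 qI = 0" "q3 qI = 0"
  "q0 qJ = 0" "q1 qJ = 0" "q2 qJ = 1" "q3 qJ = 0"
  "q0 qK = 0" "q1 qK = 0" "q2 qK = 0" "q3 qK = 1"
  by (simp_all add: qI_def qJ_def qK_def)

lemma quat_units_distinct [simp]:
  "qI \<noteq> 1" "qJ \<noteq> 1" "qK \<noteq> 1" "qI \<noteq> qJ" "qI \<noteq> qK" "qJ \<noteq> qK"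
  "1 \<noteq> qI" "1 \<noteq> qJ" "1 \<noteq> qK" "qJ \<noteq> qI" "qK \<noteq> qI" "qK \<noteq> qJ"
  by (simp_all add: quat_eq_iff)

instantiation quat :: euclidean_space
begin
definition "Basis = {1, qI, qJ, qK}"
instance
proof
  fix u v x :: quat
  show "inner u v = (if u = v then 1 else 0)" if "u \<in> Basis" "v \<in> Basis"
  proof -
    have "u = 1 \<or> u = qI \<or> u = qJ \<or> u = qK" "v = 1 \<or> v = qI \<or> v = qJ \<or> v = qK"
      using that by (auto simp: Basis_quat_def)
    then show ?thesis
      by (elim disjE; hypsubst) (simp_all add: inner_quat_def)
  qed
  show "(\<forall>u\<in>Basis. inner x u = 0) \<longleftrightarrow> x = 0"
    unfolding Basis_quat_def quat_eq_iff[of x 0] by (simp add: inner_quat_def)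
qed (simp_all add: Basis_quat_def)
end


section \<open>Indices and the embedding \<open>\<tau>\<close>\<close>

text \<open>
  Quaternionic coordinates are indexed by a finite linearly ordered type 'n standing for
  {0, ..., n-1}, where n = CARD('n). The primed index A' ranges over the two-element type 2,
  with 0 for 0' and 1 for 1' (note that 2 = 0 in this type). The unprimed index
  A = 2l + a, with a = 0 or a = 1, is \<open>CIdx l a\<close>.
\<close>

datatype 'n cindex = CIdx (blk: 'n) (pos: 2)

instance cindex :: (finite) finite
proof
  have "UNIV = (\<lambda>(l, a). CIdx l a) ` (UNIV :: ('a \<times> 2) set)"
    by (metis (no_types) UNIV_eq_I cindex.collapse old.prod.case rangeI)
  then show "finite (UNIV :: 'a cindex set)"
    by (metis finite_imageI finite_class.finite_UNIV)
qed

instantiation cindex :: (linorder) linorder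
begin
definition "A \<le> B \<longleftrightarrow> blk A < blk B \<or> (blk A = blk B \<and> pos A \<le> pos B)" for A B :: "'a cindex"
definition "A < B \<longleftrightarrow> blk A < blk B \<or> (blk A = blk B \<and> pos A < pos B)" for A B :: "'a cindex"
instance
  by standard (auto simp: less_eq_cindex_def less_cindex_def intro: cindex.expand)
end

text \<open>The space of quaternionic column vectors (as a synonym, so that the index type may
  carry a sort other than the default one of the power notation).\<close>

type_synonym 'n hspace = "(quat, 'n) vec"

text \<open>The complex 2 x 2 matrix of a quaternion.\<close>

definition qtau :: "quat \<Rightarrow> complex^2^2" where
  "qtau x = (\<chi> A B.
     if A = 0 then (if B = 0 then Complex (q0 x) (q1 x) else Complex (- q2 x) (- q3 x))
     else (if B = 0 then Complex (q2 x) (- q3 x) else Complex (q0 x) (- q1 x)))"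

definition tau :: "quat^'m^'p \<Rightarrow> complex^('m cindex)^('p cindex)" where
  "tau g = (\<chi> A B. qtau (g $ blk A $ blk B) $ pos A $ pos B)"


section \<open>The special linear group and its fractional action\<close>

text \<open>
  The n+1 homogeneous coordinates are indexed by the option type: \<open>None\<close> is the first one and
  \<open>Some l\<close> the one following it in position l.
\<close>

definition SL_quat :: "(quat^('n::finite option)^('n option)) set" where
  "SL_quat = {g. det (tau g) = 1}"

definition blk_a :: "quat^('n::finite option)^('n option) \<Rightarrow> quat" where
  "blk_a h = h $ None $ None"

definition blk_b :: "quat^('n::finite option)^('n option) \<Rightarrow> 'n hspace" where
  "blk_b h = (\<chi> m. h $ None $ Some m)"

definition blk_c :: "quat^('n::finite option)^('n option) \<Rightarrow> 'n hspace" where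
  "blk_c h = (\<chi> l. h $ Some l $ None)"

definition blk_d :: "quat^('n::finite option)^('n option) \<Rightarrow> ((quat, 'n) vec, 'n) vec" where
  "blk_d h = (\<chi> l m. h $ Some l $ Some m)"

text \<open>In the following three definitions, \<open>h\<close> plays the role of the inverse of g.\<close>

definition J1 :: "quat^('n::finite option)^('n option) \<Rightarrow> 'n hspace \<Rightarrow> quat" where
  "J1 h q = blk_a h + (\<Sum>m\<in>UNIV. blk_b h $ m * q $ m)"

definition frac_act :: "quat^('n::finite option)^('n option) \<Rightarrow> 'n hspace \<Rightarrow> 'n hspace" where
  "frac_act h q = (\<chi> l. (blk_c h + blk_d h *v q) $ l * inverse (J1 h q))"

definition J2 :: "quat^('n::finite option)^('n option) \<Rightarrow> 'n hspace \<Rightarrow> ((quat, 'n) vec, 'n) vec" where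
  "J2 h q = (\<chi> l m. blk_d h $ l $ m - frac_act h q $ l * blk_b h $ m)"


section \<open>Polynomials in commuting and Grassmann variables\<close>

text \<open>
  The complex exterior algebra on generators indexed by 'a. An element is given by its
  coefficients with respect to the basis of all increasing monomials
  \<open>\<omega>\<^sup>S = \<omega>\<^sup>A\<^sup>1 \<dots> \<omega>\<^sup>A\<^sup>r\<close>, where S = {A1 < ... < Ar}.
\<close>

typedef 'a grassmann = "UNIV :: ('a set \<Rightarrow> complex) set"
  morphisms gcoeff Grassmann ..

setup_lifting type_definition_grassmann

text \<open>For disjoint S and T, the product of the monomials of S and T is this sign times the
  monomial of their union.\<close>

definition gsign :: "'a::linorder set \<Rightarrow> 'a set \<Rightarrow> complex" where
  "gsign S T = (- 1) ^ card {(s, t). s \<in> S \<and> t \<in> T \<and> t < s}"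

lemma gsign_empty [simp]: "gsign {} T = 1" "gsign S {} = 1"
  by (simp_all add: gsign_def)

lemma gsign_Un_left:
  fixes S T U :: "'a::{finite,linorder} set"
  assumes "S \<inter> T = {}"
  shows "gsign (S \<union> T) U = gsign S U * gsign T U"
proof -
  have "{(s, u). s \<in> S \<union> T \<and> u \<in> U \<and> u < s} =
      {(s, u). s \<in> S \<and> u \<in> U \<and> u < s} \<union> {(s, u). s \<in> T \<and> u \<in> U \<and> u < s}"
    by auto
  moreover have "{(s, u). s \<in> S \<and> u \<in> U \<and> u < s} \<inter> {(s, u). s \<in> T \<and> u \<in> U \<and> u < s} = {}"
    using assms by auto
  ultimately show ?thesis
    by (simp add: gsign_def card_Un_disjoint power_add)
qed

lemma gsign_Un_right:
  fixes S T U :: "'a::{finite,linorder} set"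
  assumes "T \<inter> U = {}"
  shows "gsign S (T \<union> U) = gsign S T * gsign S U"
proof -
  have "{(s, u). s \<in> S \<and> u \<in> T \<union> U \<and> u < s} =
      {(s, u). s \<in> S \<and> u \<in> T \<and> u < s} \<union> {(s, u). s \<in> S \<and> u \<in> U \<and> u < s}"
    by auto
  moreover have "{(s, u). s \<in> S \<and> u \<in> T \<and> u < s} \<inter> {(s, u). s \<in> S \<and> u \<in> U \<and> u < s} = {}"
    using assms by auto
  ultimately show ?thesis
    by (simp add: gsign_def card_Un_disjoint power_add)
qed

instantiation grassmann :: ("{finite,linorder}") ring_1
begin

lift_definition zero_grassmann :: "'a grassmann" is "\<lambda>_. 0" .
lift_definition one_grassmann :: "'a grassmann" is "\<lambda>S. if S = {} then 1 else 0" .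
lift_definition plus_grassmann :: "'a grassmann \<Rightarrow> 'a grassmann \<Rightarrow> 'a grassmann"
  is "\<lambda>x y S. x S + y S" .
lift_definition minus_grassmann :: "'a grassmann \<Rightarrow> 'a grassmann \<Rightarrow> 'a grassmann"
  is "\<lambda>x y S. x S - y S" .
lift_definition uminus_grassmann :: "'a grassmann \<Rightarrow> 'a grassmann"
  is "\<lambda>x S. - x S" .
lift_definition times_grassmann :: "'a grassmann \<Rightarrow> 'a grassmann \<Rightarrow> 'a grassmann"
  is "\<lambda>x y S. \<Sum>T\<in>Pow S. gsign T (S - T) * x T * y (S - T)" .

instance
proof
  fix x y z :: "'a grassmann"
  show "x * y * z = x * (y * z)"
  proof transfer
    fix x y z :: "'a set \<Rightarrow> complex"
    show "(\<lambda>S. \<Sum>T\<in>Pow S. gsign T (S - T) *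
              (\<Sum>R\<in>Pow T. gsign R (T - R) * x R * y (T - R)) * z (S - T)) =
          (\<lambda>S. \<Sum>R\<in>Pow S. gsign R (S - R) * x R *
              (\<Sum>P\<in>Pow (S - R). gsign P (S - R - P) * y P * z (S - R - P)))"
    proof
      fix S :: "'a set"
      have "(\<Sum>T\<in>Pow S. gsign T (S - T) *
              (\<Sum>R\<in>Pow T. gsign R (T - R) * x R * y (T - R)) * z (S - T)) =
            (\<Sum>(T, R)\<in>Sigma (Pow S) Pow. gsign T (S - T) *
              (gsign R (T - R) * x R * y (T - R)) * z (S - T))"
        by (simp add: sum_distrib_left sum_distrib_right sum.Sigma)
      also have "\<dots> = (\<Sum>(R, P)\<in>Sigma (Pow S) (\<lambda>R. Pow (S - R)). gsign R (S - R) * x R *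
              (gsign P (S - R - P) * y P * z (S - R - P)))"
      proof (rule sum.reindex_bij_witness
          [where i = "\<lambda>(R, P). (R \<union> P, R)" and j = "\<lambda>(T, R). (R, T - R)"])
        fix a assume a: "a \<in> Sigma (Pow S) Pow"
        obtain T R where TR: "a = (T, R)" by (cases a)
        with a have sub: "R \<subseteq> T" "T \<subseteq> S" by auto
        have "gsign T (S - T) = gsign R (S - T) * gsign (T - R) (S - T)"
          using gsign_Un_left[of R "T - R" "S - T"] sub by (simp add: Un_absorb1)
        moreover have "gsign R (S - R) = gsign R (T - R) * gsign R (S - T)"
        proof -
          have "S - R = (T - R) \<union> (S - T)" using sub by auto
          then show ?thesis using gsign_Un_right[of "T - R" "S - T" R] by auto
        qed
        moreover have "S - R - (T - R) = S - T" using sub by auto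
        ultimately show "(case (case a of (T, R) \<Rightarrow> (R, T - R)) of (R, P) \<Rightarrow>
              gsign R (S - R) * x R * (gsign P (S - R - P) * y P * z (S - R - P))) =
            (case a of (T, R) \<Rightarrow> gsign T (S - T) *
              (gsign R (T - R) * x R * y (T - R)) * z (S - T))"
          using TR by (simp add: mult_ac)
      qed (auto split: prod.splits)
      also have "\<dots> = (\<Sum>R\<in>Pow S. gsign R (S - R) * x R *
              (\<Sum>P\<in>Pow (S - R). gsign P (S - R - P) * y P * z (S - R - P)))"
        by (simp add: sum_distrib_left sum.Sigma)
      finally show "(\<Sum>T\<in>Pow S. gsign T (S - T) *
              (\<Sum>R\<in>Pow T. gsign R (T - R) * x R * y (T - R)) * z (S - T)) =
            (\<Sum>R\<in>Pow S. gsign R (S - R) * x R *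
              (\<Sum>P\<in>Pow (S - R). gsign P (S - R - P) * y P * z (S - R - P)))" .
    qed
  qed
  show "1 * x = x"
  proof transfer
    fix x :: "'a set \<Rightarrow> complex"
    have "(\<Sum>T\<in>Pow S. gsign T (S - T) * (if T = {} then 1 else 0) * x (S - T)) =
        (\<Sum>T\<in>Pow S. if T = {} then x S else 0)" for S
      by (intro sum.cong) auto
    then show "(\<lambda>S. \<Sum>T\<in>Pow S. gsign T (S - T) * (if T = {} then 1 else 0) * x (S - T)) = x"
      by (simp add: fun_eq_iff)
  qed
  show "x * 1 = x"
  proof transfer
    fix x :: "'a set \<Rightarrow> complex"
    have "(\<Sum>T\<in>Pow S. gsign T (S - T) * x T * (if S - T = {} then 1 else 0)) =
        (\<Sum>T\<in>Pow S. if T = S then x S else 0)" for S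
      by (intro sum.cong) auto
    then show "(\<lambda>S. \<Sum>T\<in>Pow S. gsign T (S - T) * x T * (if S - T = {} then 1 else 0)) = x"
      by (simp add: fun_eq_iff)
  qed
  show "(x + y) * z = x * z + y * z" "x * (y + z) = x * y + x * z"
    by (transfer; simp add: distrib_left distrib_right sum.distrib)+
  show "(0::'a grassmann) \<noteq> 1"
    by transfer (auto simp: fun_eq_iff)
  show "x + y + z = x + (y + z)" "x + y = y + x" "0 + x = x" "- x + x = 0" "x - y = x + - y"
    by (transfer; simp add: add_ac)+
qed

end

text \<open>
  The algebra of polynomials in the commuting variables \<open>s\<^sub>0\<close>, \<open>s\<^sub>1\<close> and the Grassmann variables
  \<open>\<omega>\<^sup>A\<close>: a polynomial in the s-variables, given by exponent pairs, with coefficients in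
  the exterior algebra. The s-variables commute with everything. The same type serves for
  polynomials in the dual variables with upper indices; which of the two sets of
  variables is meant depends on whether \<open>j \<le> k\<close> or \<open>j \<ge> k + 1\<close>.
\<close>

type_synonym 'n sgpoly = "(nat \<times> nat) \<Rightarrow>\<^sub>0 'n cindex grassmann"

definition coef :: "'n::{finite,linorder} sgpoly \<Rightarrow> nat \<times> nat \<Rightarrow> 'n cindex set \<Rightarrow> complex" where
  "coef v e S = gcoeff (Poly_Mapping.lookup v e) S"

definition cst :: "complex \<Rightarrow> 'n::{finite,linorder} sgpoly" where
  "cst c = Poly_Mapping.single 0 (Grassmann (\<lambda>S. if S = {} then c else 0))"

definition svar :: "2 \<Rightarrow> 'n::{finite,linorder} sgpoly" where
  "svar A' = Poly_Mapping.single (if A' = 0 then (1, 0) else (0, 1)) 1"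

definition omega :: "'n cindex \<Rightarrow> 'n::{finite,linorder} sgpoly" where
  "omega A = Poly_Mapping.single 0 (Grassmann (\<lambda>S. if S = {A} then 1 else 0))"

text \<open>The partial derivative with respect to \<open>s\<^sub>A\<^sub>'\<close>; note that the term with exponent 0
  has coefficient 0.\<close>

definition sderiv :: "2 \<Rightarrow> 'n::{finite,linorder} sgpoly \<Rightarrow> 'n sgpoly" where
  "sderiv A' v = (\<Sum>(a, b)\<in>Poly_Mapping.keys v.
     if A' = 0 then Poly_Mapping.single (a - 1, b) (of_nat a * Poly_Mapping.lookup v (a, b))
     else Poly_Mapping.single (a, b - 1) (of_nat b * Poly_Mapping.lookup v (a, b)))"

text \<open>Replace each \<open>s\<^sub>A\<^sub>'\<close> by \<open>\<sigma> A'\<close> and each \<open>\<omega>\<^sup>A\<close> by \<open>\<eta> A\<close>.\<close>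

definition substitute ::
  "(2 \<Rightarrow> 'n::{finite,linorder} sgpoly) \<Rightarrow> ('n cindex \<Rightarrow> 'n sgpoly) \<Rightarrow> 'n sgpoly \<Rightarrow> 'n sgpoly" where
  "substitute \<sigma> \<eta> v = (\<Sum>(a, b)\<in>Poly_Mapping.keys v. \<Sum>S\<in>UNIV.
     cst (coef v (a, b) S) * (\<sigma> 0 ^ a * \<sigma> 1 ^ b) * prod_list (map \<eta> (sorted_list_of_set S)))"


section \<open>The spaces \<open>\<V>\<^sub>j\<close> and \<open>\<Gamma>(D, \<V>\<^sub>j)\<close>\<close>

definition s_degree :: "nat \<Rightarrow> nat \<Rightarrow> nat" where
  "s_degree k j = (if j \<le> k then k - j else j - k - 1)"

definition omega_degree :: "nat \<Rightarrow> nat \<Rightarrow> nat" where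
  "omega_degree k j = (if j \<le> k then j else j + 1)"

definition Vspace :: "nat \<Rightarrow> nat \<Rightarrow> 'n::{finite,linorder} sgpoly set" where
  "Vspace k j = {v. \<forall>a b S. coef v (a, b) S \<noteq> 0 \<longrightarrow>
     a + b = s_degree k j \<and> card S = omega_degree k j}"

text \<open>Smoothness (on open sets) via iterated Frechet derivatives.\<close>

fun Ck_on :: "nat \<Rightarrow> 'a::real_normed_vector set \<Rightarrow> ('a \<Rightarrow> 'b::real_normed_vector) \<Rightarrow> bool" where
  "Ck_on 0 D f \<longleftrightarrow> continuous_on D f"
| "Ck_on (Suc m) D f \<longleftrightarrow> (\<forall>x\<in>D. f differentiable (at x)) \<and>
     (\<forall>v. Ck_on m D (\<lambda>x. frechet_derivative f (at x) v))"

definition smooth_fun_on :: "'a::real_normed_vector set \<Rightarrow> ('a \<Rightarrow> 'b::real_normed_vector) \<Rightarrow> bool" where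
  "smooth_fun_on D f \<longleftrightarrow> (\<forall>m. Ck_on m D f)"

definition Gamma_space ::
  "nat \<Rightarrow> nat \<Rightarrow> 'n::{finite,linorder} hspace set \<Rightarrow> ('n hspace \<Rightarrow> 'n sgpoly) set" where
  "Gamma_space k j D = {f. (\<forall>q\<in>D. f q \<in> Vspace k j) \<and>
     (\<forall>e S. smooth_fun_on D (\<lambda>q. coef (f q) e S))}"


section \<open>The representations \<open>\<pi>\<^sub>j\<close>\<close>

definition act_s_lower :: "quat \<Rightarrow> 2 \<Rightarrow> 'n::{finite,linorder} sgpoly" where
  "act_s_lower p A' = (\<Sum>B'\<in>UNIV. cst (qtau p $ B' $ A') * svar B')"

definition act_s_upper :: "quat \<Rightarrow> 2 \<Rightarrow> 'n::{finite,linorder} sgpoly" where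
  "act_s_upper p A' = (\<Sum>B'\<in>UNIV. cst (qtau p $ A' $ B') * svar B')"

definition act_omega :: "((quat, 'n::{finite,linorder}) vec, 'n) vec \<Rightarrow> 'n cindex \<Rightarrow> 'n sgpoly" where
  "act_omega m A = (\<Sum>B\<in>UNIV. cst (tau m $ A $ B) * omega B)"

definition rep ::
  "nat \<Rightarrow> nat \<Rightarrow> quat^('n::{finite,linorder} option)^('n option) \<Rightarrow>
   ('n hspace \<Rightarrow> 'n sgpoly) \<Rightarrow> 'n hspace \<Rightarrow> 'n sgpoly" where
  "rep k j g f q = (let h = matrix_inv g in
     cst (complex_of_real (1 / norm (J1 h q) ^ (2 * (j + 1)))) *
     substitute
       (if j \<le> k then act_s_lower (inverse (J1 h q)) else act_s_upper (J1 h q))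
       (act_omega (J2 h q))
       (f (frac_act h q)))"


section \<open>The operators of the k-Cauchy-Fueter complex\<close>

text \<open>The derivative with respect to the real coordinate of the l-th quaternionic variable
  belonging to the unit \<open>u\<close>, one of 1, i, j, k.\<close>

definition pderiv_dir :: "'n \<Rightarrow> quat \<Rightarrow> ('n hspace \<Rightarrow> complex) \<Rightarrow> 'n::finite hspace \<Rightarrow> complex" where
  "pderiv_dir l u f q = vector_derivative (\<lambda>t::real. f (q + t *\<^sub>R axis l u)) (at 0)"

definition nabla ::
  "2 \<Rightarrow> 'n cindex \<Rightarrow> ('n hspace \<Rightarrow> complex) \<Rightarrow> 'n::finite hspace \<Rightarrow> complex" where
  "nabla A' A f q = (let l = blk A in
     if A' = 0 then
       (if pos A = 0 then (1/2) * (pderiv_dir l 1 f q - \<i> * pderiv_dir l qI f q)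
        else (1/2) * (pderiv_dir l qJ f q + \<i> * pderiv_dir l qK f q))
     else
       (if pos A = 0 then (1/2) * (- pderiv_dir l qJ f q + \<i> * pderiv_dir l qK f q)
        else (1/2) * (pderiv_dir l 1 f q + \<i> * pderiv_dir l qI f q)))"

text \<open>Coefficientwise application. For f with values in some \<open>\<V>\<^sub>j\<close> only the finitely many
  exponents of the fixed degree contribute, so \<open>Abs_poly_mapping\<close> is applied to a finitely
  supported function.\<close>

definition nabla_coef ::
  "2 \<Rightarrow> 'n cindex \<Rightarrow> ('n::{finite,linorder} hspace \<Rightarrow> 'n sgpoly) \<Rightarrow> 'n hspace \<Rightarrow> 'n sgpoly" where
  "nabla_coef A' A f q =
     Abs_poly_mapping (\<lambda>e. Grassmann (\<lambda>S. nabla A' A (\<lambda>p. coef (f p) e S) q))"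

definition d_op ::
  "2 \<Rightarrow> ('n::{finite,linorder} hspace \<Rightarrow> 'n sgpoly) \<Rightarrow> 'n hspace \<Rightarrow> 'n sgpoly" where
  "d_op A' f q = (\<Sum>A\<in>UNIV. omega A * nabla_coef A' A f q)"

definition CF_op ::
  "nat \<Rightarrow> nat \<Rightarrow> ('n::{finite,linorder} hspace \<Rightarrow> 'n sgpoly) \<Rightarrow> 'n hspace \<Rightarrow> 'n sgpoly" where
  "CF_op k j f q =
     (if j < k then cst (1/2) * (sderiv 0 (d_op 1 f q) - sderiv 1 (d_op 0 f q))
      else if j = k then cst (1/2) * (d_op 0 (d_op 1 f) q - d_op 1 (d_op 0 f) q)
      else cst (1/2) * (svar 0 * d_op 1 f q - svar 1 * d_op 0 f q))"

end

theory Submission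
  imports Defs
begin

text \<open>
  Write \<open>h\<close> for the inverse of \<open>g\<close>, \<open>\<Phi>\<close> for the map \<open>frac_act h\<close>, and use the complex coordinates
  \<open>z = \<tau>(q)\<close>, a matrix with rows \<open>A\<close> and columns \<open>A'\<close>. In these coordinates
  \<open>\<nabla>\<^sup>A\<^sup>'\<^sub>A\<close> is the partial derivative along \<open>z\<^sup>A\<^sub>A\<^sub>'\<close>, and the differential of \<open>\<Phi>\<close> is
  \<open>v \<mapsto> J2 v J1\<^sup>-\<^sup>1\<close>. Put \<open>P = \<tau>(J1\<^sup>-\<^sup>1)\<close>, \<open>\<eta>\<^sup>B = J2.\<omega>\<^sup>B\<close>, and let \<open>\<Psi>\<close> be the substitution of the
  transformed variables \<open>\<sigma>\<close> and \<open>\<eta>\<close> for \<open>s\<close> and \<open>\<omega>\<close>; it is an algebra homomorphism because the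
  \<open>\<sigma>\<close> are central and the \<open>\<eta>\<close> anticommute. The chain rule then reads
  \<open>d\<^sup>A\<^sup>' (\<phi> \<circ> \<Phi>) = \<Sum> P\<^sup>A\<^sup>'\<^sub>B\<^sub>' \<eta>\<^sup>B (\<nabla>\<^sup>B\<^sup>'\<^sub>B \<phi>) \<circ> \<Phi>\<close>.

  What remains is to differentiate the multipliers. All of their derivatives are expressed by the
  one-forms \<open>\<beta>\<^sup>A\<^sup>' = (J1\<^sup>-\<^sup>1 b)\<^sup>A\<^sup>'\<^sub>A \<omega>\<^sup>A\<close>:
  \<open>d\<^sup>A\<^sup>' \<eta>\<^sup>B = \<beta>\<^sup>A\<^sup>' \<eta>\<^sup>B\<close>, \<open>d\<^sup>A\<^sup>' |J1|\<^sup>-\<^sup>2\<^sup>l = - l \<beta>\<^sup>A\<^sup>' |J1|\<^sup>-\<^sup>2\<^sup>l\<close>, \<open>d\<^sup>A\<^sup>' P\<^sup>B\<^sup>'\<^sub>C\<^sub>' = - P\<^sup>A\<^sup>'\<^sub>C\<^sub>' \<beta>\<^sup>B\<^sup>'\<close> and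
  \<open>d\<^sup>A\<^sup>' \<beta>\<^sup>B\<^sup>' = \<beta>\<^sup>A\<^sup>' \<beta>\<^sup>B\<^sup>'\<close>. Since \<open>d\<^sup>A\<^sup>'\<close> is an antiderivation, a product of \<open>m\<close> of the \<open>\<eta>\<close> has
  \<open>d\<^sup>A\<^sup>'\<close> equal to \<open>m \<beta>\<^sup>A\<^sup>'\<close> times itself. Hence, for \<open>f\<close> of degree \<open>m\<close> in \<open>\<omega>\<close>
  (lemma \<open>has_d_op_weighted_pullback\<close>),
  \<open>d\<^sup>A\<^sup>' (|J1|\<^sup>-\<^sup>2\<^sup>l \<Psi>(f \<circ> \<Phi>))\<close> is \<open>|J1|\<^sup>-\<^sup>2\<^sup>l\<close> times
  \<open>(m - l) \<beta>\<^sup>A\<^sup>' \<Psi>(f) + \<Sum> (d\<^sup>A\<^sup>' \<sigma>\<^sub>C\<^sub>') \<Psi>(\<partial>\<^sup>C\<^sup>' f) + \<Sum> P\<^sup>A\<^sup>'\<^sub>B\<^sub>' \<Psi>(d\<^sup>B\<^sup>' f)\<close>.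

  The operators antisymmetrize in the primed index. On the last sum this produces \<open>det P = |J1|\<^sup>-\<^sup>2\<close>,
  which is exactly the change of weight from \<open>j\<close> to \<open>j + 1\<close>; the other terms must cancel, and they do
  so for a different reason in each range (\<open>l = j + 1\<close> throughout).
  For \<open>j < k\<close>, where \<open>m - l = -1\<close>, one has \<open>d\<^sup>A\<^sup>' \<sigma>\<^sub>C\<^sub>' = - P\<^sup>A\<^sup>'\<^sub>C\<^sub>' \<theta>\<close> with \<open>\<theta> = \<Sum> \<beta>\<^sup>B\<^sup>' s\<^sub>B\<^sub>'\<close>, and
  \<open>\<partial>\<^sup>B\<^sup>' \<theta> = \<beta>\<^sup>B\<^sup>'\<close> makes the contributions of the two unwanted terms opposite after antisymmetrization
  (\<open>invariance_lower\<close>).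
  For \<open>j > k\<close>, where \<open>m = l\<close>, one has \<open>d\<^sup>A\<^sup>' \<sigma>\<^sup>C\<^sup>' = s\<^sup>A\<^sup>' \<tau>(b)\<^sup>C\<^sup>'\<^sub>A \<omega>\<^sup>A\<close>, so the unwanted term is
  \<open>s\<^sup>A\<^sup>'\<close> times something independent of \<open>A'\<close> and is killed by
  \<open>s\<^sup>0 d\<^sup>1 - s\<^sup>1 d\<^sup>0\<close> (\<open>invariance_upper\<close>).
  For \<open>j = k\<close> there are no \<open>s\<close>-variables; applying \<open>d\<^sup>C\<^sup>'\<close> to the first derivative, the relations
  for \<open>d \<beta>\<close> and \<open>d P\<close> cancel everything except \<open>\<Sum> P P \<Psi>(d d f)\<close> (\<open>invariance_middle\<close>).
\<close>


section \<open>The matrix of a quaternion\<close>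

lemma UNIV_two: "UNIV = {0, 1::2}"
  using UNIV_2 by auto

lemma sum_two: "(\<Sum>A'\<in>(UNIV::2 set). F A') = F 0 + F 1"
  unfolding UNIV_two by simp

lemma two_cases: "x = 0 \<or> x = (1::2)"
  using UNIV_two by blast

lemma qtau_entries:
  "qtau x $ 0 $ 0 = of_real (q0 x) + \<i> * of_real (q1 x)"
  "qtau x $ 0 $ 1 = - of_real (q2 x) - \<i> * of_real (q3 x)"
  "qtau x $ 1 $ 0 = of_real (q2 x) - \<i> * of_real (q3 x)"
  "qtau x $ 1 $ 1 = of_real (q0 x) - \<i> * of_real (q1 x)"
  by (simp_all add: qtau_def complex_eq_iff)

lemma qtau_linear_simps:
  "qtau 0 $ i $ j = 0" "qtau (x + y) $ i $ j = qtau x $ i $ j + qtau y $ i $ j"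
  "qtau (- x) $ i $ j = - qtau x $ i $ j" "qtau (x - y) $ i $ j = qtau x $ i $ j - qtau y $ i $ j"
  "qtau (r *\<^sub>R x) $ i $ j = r *\<^sub>R qtau x $ i $ j"
  using two_cases[of i] two_cases[of j]
  by (auto simp: qtau_def complex_eq_iff)

lemma qtau_sum: "qtau (\<Sum>m\<in>I. x m) $ i $ j = (\<Sum>m\<in>I. qtau (x m) $ i $ j)"
  by (induction I rule: infinite_finite_induct) (simp_all add: qtau_linear_simps)

lemma qtau_mult: "qtau (x * y) $ i $ j = (\<Sum>k\<in>UNIV. qtau x $ i $ k * qtau y $ k $ j)"
proof -
  have ii: "\<i> * (\<i> * z) = - z" for z by (simp flip: mult.assoc)
  show ?thesis
    using two_cases[of i] two_cases[of j]
    by (auto simp: qtau_entries sum_two algebra_simps ii)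
qed

lemma qtau_1: "qtau 1 $ i $ j = (if i = j then 1 else 0)"
  using two_cases[of i] two_cases[of j] by (auto simp: qtau_entries)

lemma det_qtau:
  "qtau x $ 0 $ 0 * qtau x $ 1 $ 1 - qtau x $ 0 $ 1 * qtau x $ 1 $ 0 = complex_of_real ((norm x)\<^sup>2)"
  by (simp add: qtau_entries norm_quat_def inner_quat_def complex_eq_iff algebra_simps power2_eq_square)

lemma has_derivative_qtau:
  assumes "(F has_derivative F') net"
  shows "((\<lambda>p. qtau (F p) $ i $ j) has_derivative (\<lambda>v. qtau (F' v) $ i $ j)) net"
proof (rule bounded_linear.has_derivative[OF _ assms])
  show "bounded_linear (\<lambda>x. qtau x $ i $ j)"
    unfolding linear_conv_bounded_linear[symmetric]
    by (intro linearI) (simp_all add: qtau_linear_simps)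
qed


section \<open>Grassmann variables\<close>

definition gmonomial :: "'a set \<Rightarrow> 'a grassmann" where
  "gmonomial S = Grassmann (\<lambda>T. if T = S then 1 else 0)"

definition gcst :: "complex \<Rightarrow> 'a grassmann" where
  "gcst c = Grassmann (\<lambda>S. if S = {} then c else 0)"

lemma grassmann_eqI: "(\<And>S. gcoeff x S = gcoeff y S) \<Longrightarrow> x = y"
  by (metis (no_types, lifting) ext gcoeff_inverse)

lemma gcoeff_simps [simp]:
  fixes x y :: "'a::{finite,linorder} grassmann"
  shows "gcoeff 0 S = 0" "gcoeff (x + y) S = gcoeff x S + gcoeff y S"
    "gcoeff (- x) S = - gcoeff x S" "gcoeff (x - y) S = gcoeff x S - gcoeff y S"
    "gcoeff (Grassmann h) S = h S"
    by (simp_all add: zero_grassmann.rep_eq plus_grassmann.rep_eq uminus_grassmann.rep_eq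
        minus_grassmann.rep_eq Grassmann_inverse)

lemma gcoeff_sum:
  fixes h :: "'i \<Rightarrow> 'a::{finite,linorder} grassmann"
  shows "gcoeff (\<Sum>i\<in>I. h i) S = (\<Sum>i\<in>I. gcoeff (h i) S)"
  by (induction I rule: infinite_finite_induct) simp_all

lemma gcoeff_gcst_mult:
  fixes x :: "'a::{finite,linorder} grassmann"
  shows "gcoeff (gcst c * x) S = c * gcoeff x S"
proof -
  have "gcoeff (gcst c * x) S =
      (\<Sum>T\<in>Pow S. gsign T (S - T) * (if T = {} then c else 0) * gcoeff x (S - T))"
    by (simp add: times_grassmann.rep_eq gcst_def)
  also have "\<dots> = (\<Sum>T\<in>Pow S. if T = {} then c * gcoeff x S else 0)"
    by (intro sum.cong) auto
  finally show ?thesis by simp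
qed

lemma gcoeff_mult_gcst:
  fixes x :: "'a::{finite,linorder} grassmann"
  shows "gcoeff (x * gcst c) S = c * gcoeff x S"
proof -
  have "gcoeff (x * gcst c) S =
      (\<Sum>T\<in>Pow S. gsign T (S - T) * gcoeff x T * (if S - T = {} then c else 0))"
    by (simp add: times_grassmann.rep_eq gcst_def)
  also have "\<dots> = (\<Sum>T\<in>Pow S. if T = S then c * gcoeff x S else 0)"
    by (intro sum.cong) auto
  finally show ?thesis by simp
qed

lemma gcst_commute: "gcst c * x = x * gcst c"
  for x :: "'a::{finite,linorder} grassmann"
  by (rule grassmann_eqI) (simp add: gcoeff_gcst_mult gcoeff_mult_gcst)

text \<open>
  Left multiplication by a single generator is the only product of monomials that is needed:
  the operators and the substitution are both generated by it.
\<close>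

lemma gmonomial_singleton_mult:
  fixes A :: "'a::{finite,linorder}"
  shows "gmonomial {A} * gmonomial S =
    (if A \<in> S then 0 else gcst (gsign {A} S) * gmonomial (insert A S))"
proof (rule grassmann_eqI)
  fix U
  have "gcoeff (gmonomial {A} * gmonomial S) U =
      (\<Sum>T\<in>Pow U. gsign T (U - T) * (if T = {A} then 1 else 0) * (if U - T = S then 1 else 0))"
    by (simp add: times_grassmann.rep_eq gmonomial_def)
  also have "\<dots> = (\<Sum>T\<in>Pow U. if T = {A} then (if U - {A} = S then gsign {A} S else 0) else 0)"
    by (intro sum.cong) auto
  also have "\<dots> = (if {A} \<in> Pow U then (if U - {A} = S then gsign {A} S else 0) else 0)"
    by (subst sum.delta) auto
  also have "\<dots> = gcoeff (if A \<in> S then 0 else gcst (gsign {A} S) * gmonomial (insert A S)) U"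
    by (auto simp: gcoeff_gcst_mult gmonomial_def)
  finally show "gcoeff (gmonomial {A} * gmonomial S) U =
      gcoeff (if A \<in> S then 0 else gcst (gsign {A} S) * gmonomial (insert A S)) U" .
qed

lemma gmonomial_anticommute:
  fixes A B :: "'a::{finite,linorder}"
  shows "gmonomial {A} * gmonomial {B} = - (gmonomial {B} * gmonomial {A})"
proof (cases "A = B")
  case True
  then show ?thesis by (simp add: gmonomial_singleton_mult)
next
  case False
  have *: "{(s, t). s = X \<and> t = Y \<and> t < s} = (if Y < X then {(X, Y)} else {})" for X Y :: 'a
    by auto
  have "gsign {A} {B} = - gsign {B} {A}"
    using False by (auto simp: gsign_def * not_less)
  then show ?thesis
    using False by (intro grassmann_eqI)
      (simp add: gmonomial_singleton_mult gcoeff_gcst_mult insert_commute)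
qed

lemma grassmann_expand:
  fixes x :: "'a::{finite,linorder} grassmann"
  shows "x = (\<Sum>S\<in>UNIV. gcst (gcoeff x S) * gmonomial S)"
proof (rule grassmann_eqI)
  fix T
  have "gcoeff (\<Sum>S\<in>UNIV. gcst (gcoeff x S) * gmonomial S) T =
      (\<Sum>S\<in>UNIV. if T = S then gcoeff x S else 0)"
    unfolding gcoeff_sum by (intro sum.cong) (auto simp: gcoeff_gcst_mult gmonomial_def)
  then show "gcoeff x T = gcoeff (\<Sum>S\<in>UNIV. gcst (gcoeff x S) * gmonomial S) T"
    by simp
qed


section \<open>Polynomials in commuting and Grassmann variables\<close>

definition monomial :: "nat \<times> nat \<Rightarrow> 'n cindex set \<Rightarrow> 'n::{finite,linorder} sgpoly" where
  "monomial e S = Poly_Mapping.single e (gmonomial S)"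

lemma cst_eq: "cst c = Poly_Mapping.single 0 (gcst c)"
  by (simp add: cst_def gcst_def)

lemma omega_eq: "omega A = monomial 0 {A}"
  by (simp add: omega_def monomial_def gmonomial_def)

lemma lookup_sum: "Poly_Mapping.lookup (\<Sum>i\<in>I. h i) e = (\<Sum>i\<in>I. Poly_Mapping.lookup (h i) e)"
  by (induction I rule: infinite_finite_induct) (simp_all add: lookup_add)

lemma sum_singles:
  assumes "finite E" "Poly_Mapping.keys v \<subseteq> E"
  shows "v = (\<Sum>e\<in>E. Poly_Mapping.single e (Poly_Mapping.lookup v e))"
proof (rule poly_mapping_eqI)
  fix e
  have "Poly_Mapping.lookup (\<Sum>e\<in>E. Poly_Mapping.single e (Poly_Mapping.lookup v e)) e =
     (\<Sum>i\<in>E. if i = e then Poly_Mapping.lookup v e else 0)"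
    unfolding lookup_sum by (intro sum.cong) (auto simp: lookup_single)
  then show "Poly_Mapping.lookup v e =
      Poly_Mapping.lookup (\<Sum>e\<in>E. Poly_Mapping.single e (Poly_Mapping.lookup v e)) e"
    using assms by (auto simp: in_keys_iff)
qed

lemma sgpoly_expand:
  fixes v :: "'n::{finite,linorder} sgpoly"
  assumes "finite E" "Poly_Mapping.keys v \<subseteq> E"
  shows "v = (\<Sum>e\<in>E. \<Sum>S\<in>UNIV. cst (coef v e S) * monomial e S)"
proof -
  have "Poly_Mapping.single e (Poly_Mapping.lookup v e) = (\<Sum>S\<in>UNIV. cst (coef v e S) * monomial e S)" for e
  proof -
    have *: "Poly_Mapping.single e (\<Sum>S\<in>I. h S) = (\<Sum>S\<in>I. Poly_Mapping.single e (h S))"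
      if "finite I" for I and h :: "'n cindex set \<Rightarrow> 'n cindex grassmann"
      using that by induction (simp_all add: single_add)
    show ?thesis
      by (subst grassmann_expand) (simp add: * cst_eq monomial_def mult_single coef_def)
  qed
  with sum_singles[OF assms] show ?thesis by simp
qed

lemma sgpoly_eqI: "(\<And>e S. coef v e S = coef w e S) \<Longrightarrow> v = w"
  by (intro poly_mapping_eqI grassmann_eqI) (simp add: coef_def)

text \<open>
  Used for identities that are linear over the complex numbers, such as the homomorphism property
  of a substitution: it is then enough to look at monomials.
\<close>

lemma sgpoly_induct [case_names zero add cst_mult monomial]:
  fixes v :: "'n::{finite,linorder} sgpoly"
  assumes "P 0" "\<And>v w. P v \<Longrightarrow> P w \<Longrightarrow> P (v + w)"
    and "\<And>c v. P v \<Longrightarrow> P (cst c * v)" and "\<And>e S. P (monomial e S)"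
  shows "P v"
proof -
  have *: "P (\<Sum>i\<in>I. h i)" if "\<And>i. P (h i)" for I :: "'i set" and h
    using that assms(1,2) by (induction I rule: infinite_finite_induct) auto
  have "P (\<Sum>e\<in>Poly_Mapping.keys v. \<Sum>S\<in>UNIV. cst (coef v e S) * monomial e S)"
    by (intro * assms)
  then show ?thesis
    using sgpoly_expand[of "Poly_Mapping.keys v" v] by simp
qed

lemma cst_simps:
  fixes a b :: complex
  shows "cst 0 = (0 :: 'n::{finite,linorder} sgpoly)" "cst 1 = (1 :: 'n sgpoly)"
    "cst (a + b) = cst a + (cst b :: 'n sgpoly)" "cst (- a) = - (cst a :: 'n sgpoly)"
    "cst (a - b) = cst a - (cst b :: 'n sgpoly)" "cst (a * b) = cst a * (cst b :: 'n sgpoly)"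
proof -
  have g: "gcst 0 = (0 :: 'n cindex grassmann)" "gcst 1 = (1 :: 'n cindex grassmann)"
    "gcst (a + b) = gcst a + (gcst b :: 'n cindex grassmann)"
    "gcst (- a) = - (gcst a :: 'n cindex grassmann)"
    "gcst (a - b) = gcst a - (gcst b :: 'n cindex grassmann)"
    by (rule grassmann_eqI; simp add: gcst_def one_grassmann.rep_eq)+
  have m: "gcst (a * b) = gcst a * (gcst b :: 'n cindex grassmann)"
    by (rule grassmann_eqI, simp add: gcoeff_gcst_mult, simp add: gcst_def)
  show "cst 0 = (0 :: 'n sgpoly)" "cst 1 = (1 :: 'n sgpoly)" "cst (a + b) = cst a + (cst b :: 'n sgpoly)"
    "cst (- a) = - (cst a :: 'n sgpoly)"
    "cst (a - b) = cst a - (cst b :: 'n sgpoly)" "cst (a * b) = cst a * (cst b :: 'n sgpoly)"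
    by (simp_all add: cst_eq g m single_add single_uminus single_diff mult_single)
qed

lemma cst_sum: "cst (\<Sum>i\<in>I. h i) = (\<Sum>i\<in>I. cst (h i))"
  by (induction I rule: infinite_finite_induct) (simp_all add: cst_simps)

lemma cst_of_nat: "cst (of_nat m) = of_nat m"
  by (induction m) (simp_all add: cst_simps)

lemma single_commute:
  fixes v :: "'n::{finite,linorder} sgpoly"
  assumes "\<And>x. g * x = x * g"
  shows "Poly_Mapping.single e g * v = v * Poly_Mapping.single e g"
proof -
  have "v = (\<Sum>d\<in>Poly_Mapping.keys v. Poly_Mapping.single d (Poly_Mapping.lookup v d))"
    by (rule sum_singles) auto
  moreover have "Poly_Mapping.single e g * (\<Sum>d\<in>Poly_Mapping.keys v. Poly_Mapping.single d (Poly_Mapping.lookup v d))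
    = (\<Sum>d\<in>Poly_Mapping.keys v. Poly_Mapping.single d (Poly_Mapping.lookup v d)) * Poly_Mapping.single e g"
    unfolding sum_distrib_left sum_distrib_right
    by (intro sum.cong refl) (simp add: mult_single assms add.commute)
  ultimately show ?thesis by simp
qed

lemma cst_commute: "cst c * v = v * cst c"
  unfolding cst_eq by (rule single_commute) (rule gcst_commute)

lemma svar_commute: "svar A' * v = v * svar A'"
  unfolding svar_def by (rule single_commute) simp

lemma omega_anticommute: "omega A * omega B = - (omega B * omega A)"
  by (simp add: omega_eq monomial_def mult_single gmonomial_anticommute[of A B] flip: single_uminus)

lemma omega_mult_monomial:
  "omega A * monomial e S = (if A \<in> S then 0 else cst (gsign {A} S) * monomial e (insert A S))"
  by (simp add: omega_eq monomial_def mult_single gmonomial_singleton_mult cst_eq)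

lemma coef_simps [simp]:
  "coef 0 e S = 0" "coef (v + w) e S = coef v e S + coef w e S"
  "coef (- v) e S = - coef v e S" "coef (v - w) e S = coef v e S - coef w e S"
  by (simp_all add: coef_def lookup_add lookup_minus)

lemma coef_sum: "coef (\<Sum>i\<in>I. h i) e S = (\<Sum>i\<in>I. coef (h i) e S)"
  by (induction I rule: infinite_finite_induct) simp_all

lemma coef_cst_mult: "coef (cst c * v) e S = c * coef v e S"
proof -
  have v: "v = (\<Sum>d\<in>Poly_Mapping.keys v. Poly_Mapping.single d (Poly_Mapping.lookup v d))"
    by (rule sum_singles) auto
  have "cst c * v = (\<Sum>d\<in>Poly_Mapping.keys v. Poly_Mapping.single d (gcst c * Poly_Mapping.lookup v d))"
    by (subst v) (simp add: sum_distrib_left cst_eq mult_single)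
  then have "coef (cst c * v) e S = (\<Sum>d\<in>Poly_Mapping.keys v.
      coef (Poly_Mapping.single d (gcst c * Poly_Mapping.lookup v d)) e S)"
    by (simp only: coef_sum)
  also have "\<dots> = (\<Sum>d\<in>Poly_Mapping.keys v. if d = e then c * coef v e S else 0)"
    by (rule sum.cong) (auto simp: coef_def lookup_single gcoeff_gcst_mult)
  also have "\<dots> = c * coef v e S"
    by (auto simp: coef_def in_keys_iff)
  finally show ?thesis .
qed

lemma coef_monomial: "coef (monomial e S) e' S' = (if e' = e \<and> S' = S then 1 else 0)"
  by (auto simp: coef_def monomial_def lookup_single gmonomial_def when_def)

lemma coef_omega_mult:
  "coef (omega A * v) e S = (if A \<in> S then gsign {A} (S - {A}) * coef v e (S - {A}) else 0)"
proof (induction v rule: sgpoly_induct)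
  case (cst_mult c v)
  have "omega A * (cst c * v) = cst c * (omega A * v)"
    by (metis cst_commute mult.assoc)
  then show ?case using cst_mult by (simp add: coef_cst_mult)
next
  case (monomial d T)
  then show ?case
    by (auto simp: omega_mult_monomial coef_cst_mult coef_monomial)
qed (simp_all add: distrib_left algebra_simps)

lemma cst_left_commute: "x * (cst c * v) = cst c * (x * v)"
proof -
  have "x * (cst c * v) = x * cst c * v" by (simp only: mult.assoc)
  also have "\<dots> = cst c * x * v" by (simp only: cst_commute[of c x])
  finally show ?thesis by (simp only: mult.assoc)
qed

lemma of_nat_left_commute: "x * (of_nat m * y) = of_nat m * (x * y)"
  for x y :: "'n::{finite,linorder} sgpoly"
  by (simp only: cst_of_nat[symmetric] cst_left_commute)


section \<open>Partial derivatives in the commuting variables\<close>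

text \<open>
  For additive identities that are bilinear in two polynomials: unlike monomials, the terms
  \<open>s\<^sup>e x\<close> with an arbitrary Grassmann coefficient \<open>x\<close> are closed under multiplication.
\<close>

lemma sgpoly_single_induct [case_names single add]:
  fixes v :: "'n::{finite,linorder} sgpoly"
  assumes "\<And>e x. P (Poly_Mapping.single e x)" "\<And>v w. P v \<Longrightarrow> P w \<Longrightarrow> P (v + w)"
  shows "P v"
proof -
  have "P (0 :: 'n sgpoly)" using assms(1)[of 0 0] by simp
  then have *: "P (\<Sum>i\<in>I. h i)" if "\<And>i. P (h i)" for I :: "'i set" and h
    using that assms(2) by (induction I rule: infinite_finite_induct) auto
  have "P (\<Sum>e\<in>Poly_Mapping.keys v. Poly_Mapping.single e (Poly_Mapping.lookup v e))"
    by (intro * assms)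
  then show ?thesis
    using sum_singles[of "Poly_Mapping.keys v" v] by simp
qed

lemma sderiv_superset:
  assumes "finite E" "Poly_Mapping.keys v \<subseteq> E"
  shows "sderiv A' v = (\<Sum>(a, b)\<in>E.
     if A' = 0 then Poly_Mapping.single (a - 1, b) (of_nat a * Poly_Mapping.lookup v (a, b))
     else Poly_Mapping.single (a, b - 1) (of_nat b * Poly_Mapping.lookup v (a, b)))"
  unfolding sderiv_def using assms
  by (intro sum.mono_neutral_left) (auto simp: in_keys_iff)

lemma sderiv_add: "sderiv A' (v + w) = sderiv A' v + sderiv A' w"
proof -
  let ?E = "Poly_Mapping.keys v \<union> Poly_Mapping.keys w"
  have *: "finite ?E" "Poly_Mapping.keys v \<subseteq> ?E" "Poly_Mapping.keys w \<subseteq> ?E"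
    "Poly_Mapping.keys (v + w) \<subseteq> ?E"
    using keys_add[of v w] by auto
  show ?thesis
    by (simp only: sderiv_superset[OF *(1,2)] sderiv_superset[OF *(1,3)]
        sderiv_superset[OF *(1,4)] flip: sum.distrib)
      (auto intro!: sum.cong simp: lookup_add distrib_left single_add split: if_splits)
qed

lemma sderiv_single:
  "sderiv 0 (Poly_Mapping.single (a, b) x) = Poly_Mapping.single (a - 1, b) (of_nat a * x)"
  "sderiv 1 (Poly_Mapping.single (a, b) x) = Poly_Mapping.single (a, b - 1) (of_nat b * x)"
proof -
  have *: "finite {(a, b)}" "Poly_Mapping.keys (Poly_Mapping.single (a, b) x) \<subseteq> {(a, b)}"
    by auto
  show "sderiv 0 (Poly_Mapping.single (a, b) x) = Poly_Mapping.single (a - 1, b) (of_nat a * x)"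
    "sderiv 1 (Poly_Mapping.single (a, b) x) = Poly_Mapping.single (a, b - 1) (of_nat b * x)"
    unfolding sderiv_superset[OF *] by simp_all
qed

text \<open>
  The commuting variables are even, so there is no sign in this Leibniz rule.
\<close>

lemma sderiv_mult: "sderiv A' (v * w) = sderiv A' v * w + v * sderiv A' w"
proof (induction v rule: sgpoly_single_induct)
  case (single e x)
  obtain a b where e: "e = (a, b)" by force
  show ?case
  proof (induction w rule: sgpoly_single_induct)
    case (single d y)
    obtain a' b' where d: "d = (a', b')" by force
    have c: "x * (of_nat m * y) = of_nat m * (x * y)" for m
      by (metis mult.assoc mult_of_nat_commute)
    have "A' = 0 \<or> A' = 1" using two_cases by blast
    then show ?case
    proof
      assume "A' = 0"
      then show ?thesis
        by (cases a; cases a') (simp_all add: e d mult_single sderiv_single c mult.assoc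
          algebra_simps flip: single_add)
    next
      assume "A' = 1"
      then show ?thesis
        by (cases b; cases b') (simp_all add: e d mult_single sderiv_single c mult.assoc
          algebra_simps flip: single_add)
    qed
  qed (simp add: distrib_left sderiv_add)
qed (simp add: distrib_right sderiv_add)

lemma sderiv_simps:
  "sderiv A' (0 :: 'n::{finite,linorder} sgpoly) = 0"
  "sderiv A' (1 :: 'n::{finite,linorder} sgpoly) = 0"
  "sderiv A' (cst c :: 'n::{finite,linorder} sgpoly) = 0"
  "sderiv A' (omega A :: 'n::{finite,linorder} sgpoly) = 0"
  "sderiv A' (svar B' :: 'n::{finite,linorder} sgpoly) = (if A' = B' then 1 else 0)"
proof -
  have z: "0 = (0::nat, 0::nat)" by (simp add: zero_prod_def)
  have A: "A' = 0 \<or> A' = 1" "B' = 0 \<or> B' = 1" using two_cases by blast+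
  show c: "sderiv A' (cst c :: 'n::{finite,linorder} sgpoly) = 0" for c
    using A by (auto simp: cst_eq z sderiv_single)
  show "sderiv A' (0 :: 'n::{finite,linorder} sgpoly) = 0"
  "sderiv A' (1 :: 'n::{finite,linorder} sgpoly) = 0"
    using c[of 0] c[of 1] by (simp_all add: cst_simps)
  show "sderiv A' (omega A :: 'n::{finite,linorder} sgpoly) = 0"
    using A by (auto simp: omega_def z sderiv_single)
  show "sderiv A' (svar B' :: 'n::{finite,linorder} sgpoly) = (if A' = B' then 1 else 0)"
    using A by (auto simp: svar_def sderiv_single simp flip: z)
qed

lemma sderiv_cst_mult: "sderiv A' (cst c * v) = cst c * sderiv A' v"
  by (simp add: sderiv_mult sderiv_simps)

lemma sderiv_uminus: "sderiv A' (- v) = - sderiv A' v"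
  using sderiv_add[of A' v "- v"] by (simp add: sderiv_simps eq_neg_iff_add_eq_0 add.commute)

lemma sderiv_diff: "sderiv A' (v - w) = sderiv A' v - sderiv A' w"
  using sderiv_add[of A' v "- w"] by (simp add: sderiv_uminus)

lemma sderiv_sum: "sderiv A' (\<Sum>i\<in>I. h i) = (\<Sum>i\<in>I. sderiv A' (h i))"
  by (induction I rule: infinite_finite_induct) (simp_all add: sderiv_simps sderiv_add)

lemma sderiv_commute: "sderiv A' (sderiv B' v) = sderiv B' (sderiv A' v)"
proof (induction v rule: sgpoly_single_induct)
  case (single e x)
  obtain a b where e: "e = (a, b)" by force
  have A: "A' = 0 \<or> A' = 1" "B' = 0 \<or> B' = 1" using two_cases by blast+
  have "of_nat a * (of_nat b * x) = of_nat b * (of_nat a * x)"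
    by (metis mult.assoc mult_of_nat_commute)
  then show ?case using A by (auto simp: e sderiv_single)
qed (simp add: sderiv_add)

lemma sderiv_monomial:
  fixes S :: "'n::{finite,linorder} cindex set"
  shows "sderiv 0 (monomial (a, b) S) = of_nat a * monomial (a - 1, b) S"
  "sderiv 1 (monomial (a, b) S) = of_nat b * monomial (a, b - 1) S"
proof -
  have "of_nat m * Poly_Mapping.single e x = Poly_Mapping.single e (of_nat m * x)"
    for m and e :: "nat \<times> nat" and x :: "'n cindex grassmann"
    by (induction m) (simp_all add: distrib_right single_add)
  then show "sderiv 0 (monomial (a, b) S) = of_nat a * monomial (a - 1, b) S"
    "sderiv 1 (monomial (a, b) S) = of_nat b * monomial (a, b - 1) S"
    by (simp_all add: monomial_def sderiv_single)
qed

lemma sderiv_power: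
  assumes "\<And>v. x * v = v * x"
  shows "sderiv A' (x ^ m) = of_nat m * x ^ (m - 1) * sderiv A' x"
proof (induction m)
  case (Suc m)
  have "x * (of_nat m * x ^ (m - 1) * sderiv A' x) = of_nat m * x ^ m * sderiv A' x"
    by (cases m) (simp_all add: of_nat_left_commute mult.assoc del: of_nat_Suc)
  moreover have "sderiv A' x * x ^ m = x ^ m * sderiv A' x"
    by (induction m) (simp_all, metis assms mult.assoc)
  ultimately show ?case
    by (simp add: sderiv_mult Suc distrib_right mult.assoc)
qed (simp add: sderiv_simps)


section \<open>Substitution as an algebra homomorphism\<close>

definition anti_monomial :: "('n cindex \<Rightarrow> 'n sgpoly) \<Rightarrow> 'n cindex set \<Rightarrow> 'n::{finite,linorder} sgpoly" where
  "anti_monomial \<eta> S = prod_list (map \<eta> (sorted_list_of_set S))"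

lemma sderiv_anti_monomial:
  assumes "\<And>A. sderiv A' (\<eta> A) = 0"
  shows "sderiv A' (anti_monomial \<eta> S) = 0"
proof -
  have "sderiv A' (prod_list (map \<eta> xs)) = 0" for xs
    by (induction xs) (simp_all add: sderiv_simps sderiv_mult assms)
  then show ?thesis by (simp add: anti_monomial_def)
qed

text \<open>
  The relations between the variables that a substitution has to respect in order to be an algebra
  homomorphism. Squares of the \<open>\<eta> A\<close> vanish by taking \<open>A = B\<close>.
\<close>

locale substitution =
  fixes \<sigma> :: "2 \<Rightarrow> 'n::{finite,linorder} sgpoly" and \<eta> :: "'n cindex \<Rightarrow> 'n sgpoly"
  assumes central: "\<sigma> A' * v = v * \<sigma> A'"
    and anticommuting: "\<eta> A * \<eta> B = - (\<eta> B * \<eta> A)"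
begin

text \<open>
  The sum over the support is replaced by a sum over a fixed finite set of exponents, so that
  substitutions into different polynomials can be compared term by term.
\<close>

lemma substitute_superset:
  assumes "finite E" "Poly_Mapping.keys v \<subseteq> E"
  shows "substitute \<sigma> \<eta> v = (\<Sum>e\<in>E. \<Sum>S\<in>UNIV.
     cst (coef v e S) * (\<sigma> 0 ^ fst e * \<sigma> 1 ^ snd e * anti_monomial \<eta> S))"
proof -
  have "substitute \<sigma> \<eta> v = (\<Sum>e\<in>Poly_Mapping.keys v. \<Sum>S\<in>UNIV.
     cst (coef v e S) * (\<sigma> 0 ^ fst e * \<sigma> 1 ^ snd e * anti_monomial \<eta> S))"
    by (simp add: substitute_def anti_monomial_def case_prod_beta mult.assoc)
  also have "\<dots> = (\<Sum>e\<in>E. \<Sum>S\<in>UNIV.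
     cst (coef v e S) * (\<sigma> 0 ^ fst e * \<sigma> 1 ^ snd e * anti_monomial \<eta> S))"
    using assms by (intro sum.mono_neutral_left)
      (auto simp: in_keys_iff coef_def cst_simps)
  finally show ?thesis .
qed

lemma substitute_add: "substitute \<sigma> \<eta> (v + w) = substitute \<sigma> \<eta> v + substitute \<sigma> \<eta> w"
proof -
  let ?E = "Poly_Mapping.keys v \<union> Poly_Mapping.keys w"
  have *: "finite ?E" "Poly_Mapping.keys v \<subseteq> ?E" "Poly_Mapping.keys w \<subseteq> ?E"
    "Poly_Mapping.keys (v + w) \<subseteq> ?E"
    using keys_add[of v w] by auto
  show ?thesis
    by (simp only: substitute_superset[OF *(1,2)] substitute_superset[OF *(1,3)]
        substitute_superset[OF *(1,4)] flip: sum.distrib)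
      (simp add: cst_simps distrib_right)
qed

lemma substitute_0: "substitute \<sigma> \<eta> 0 = 0"
  by (simp add: substitute_def)

lemma keys_cst_mult: "Poly_Mapping.keys (cst c * v) \<subseteq> Poly_Mapping.keys v"
  by (auto simp: in_keys_iff intro!: grassmann_eqI)
    (metis coef_cst_mult coef_def gcoeff_simps(1) mult_zero_right)

lemma substitute_cst_mult: "substitute \<sigma> \<eta> (cst c * v) = cst c * substitute \<sigma> \<eta> v"
  using substitute_superset[OF _ keys_cst_mult, of v c]
    substitute_superset[of "Poly_Mapping.keys v" v]
  by (simp add: coef_cst_mult cst_simps sum_distrib_left mult.assoc)

lemma substitute_uminus: "substitute \<sigma> \<eta> (- v) = - substitute \<sigma> \<eta> v"
  using substitute_cst_mult[of "-1" v] by (simp add: cst_simps)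

lemma substitute_diff: "substitute \<sigma> \<eta> (v - w) = substitute \<sigma> \<eta> v - substitute \<sigma> \<eta> w"
  using substitute_add[of v "- w"] by (simp add: substitute_uminus)

lemma substitute_sum: "substitute \<sigma> \<eta> (\<Sum>i\<in>I. h i) = (\<Sum>i\<in>I. substitute \<sigma> \<eta> (h i))"
  by (induction I rule: infinite_finite_induct) (simp_all add: substitute_0 substitute_add)

lemma substitute_of_nat_mult: "substitute \<sigma> \<eta> (of_nat m * v) = of_nat m * substitute \<sigma> \<eta> v"
  by (metis cst_of_nat substitute_cst_mult)

lemma substitute_monomial:
  "substitute \<sigma> \<eta> (monomial (a, b) S) = \<sigma> 0 ^ a * \<sigma> 1 ^ b * anti_monomial \<eta> S"
proof -
  have "Poly_Mapping.keys (monomial (a, b) S) \<subseteq> {(a, b)}" by (auto simp: monomial_def)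
  from substitute_superset[OF _ this]
  have "substitute \<sigma> \<eta> (monomial (a, b) S) = (\<Sum>T\<in>UNIV.
     cst (coef (monomial (a, b) S) (a, b) T) * (\<sigma> 0 ^ a * \<sigma> 1 ^ b * anti_monomial \<eta> T))"
    by simp
  also have "\<dots> = (\<Sum>T\<in>UNIV. if T = S then \<sigma> 0 ^ a * \<sigma> 1 ^ b * anti_monomial \<eta> S else 0)"
    by (intro sum.cong) (auto simp: coef_monomial cst_simps)
  finally show ?thesis by simp
qed

lemma central_power: "\<sigma> A' ^ m * v = v * \<sigma> A' ^ m"
  by (induction m) (simp_all, metis central mult.assoc)

lemma central_powers: "\<sigma> 0 ^ a * \<sigma> 1 ^ b * v = v * (\<sigma> 0 ^ a * \<sigma> 1 ^ b)"
proof -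
  have "\<sigma> 0 ^ a * \<sigma> 1 ^ b * v = \<sigma> 0 ^ a * (v * \<sigma> 1 ^ b)"
    unfolding mult.assoc central_power[of 1 b v] ..
  also have "\<dots> = v * \<sigma> 0 ^ a * \<sigma> 1 ^ b"
    unfolding mult.assoc[symmetric] central_power[of 0 a v] ..
  finally show ?thesis by (simp only: mult.assoc)
qed

lemma substitute_svar_mult: "substitute \<sigma> \<eta> (svar A' * v) = \<sigma> A' * substitute \<sigma> \<eta> v"
proof (induction v rule: sgpoly_induct)
  case (cst_mult c v)
  then show ?case
    by (simp add: substitute_cst_mult cst_left_commute)
next
  case (monomial e S)
  obtain a b where e: "e = (a, b)" by force
  have "A' = 0 \<or> A' = 1" using two_cases by blast
  then show ?case
  proof
    assume "A' = 0"
    then show ?thesis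
      using substitute_monomial[of "Suc a" b S] substitute_monomial[of a b S]
      by (simp add: e monomial_def svar_def mult_single mult.assoc)
  next
    assume "A' = 1"
    have "\<sigma> 0 ^ a * (\<sigma> 1 * w) = \<sigma> 1 * (\<sigma> 0 ^ a * w)" for w
      using central_power[of 0 a "\<sigma> 1"] by (simp flip: mult.assoc)
    with \<open>A' = 1\<close> show ?thesis
      using substitute_monomial[of a "Suc b" S] substitute_monomial[of a b S]
      by (simp add: e monomial_def svar_def mult_single mult.assoc)
  qed
qed (simp_all add: distrib_left substitute_add substitute_0)

text \<open>
  Moving \<open>\<eta> A\<close> to its place in an increasing product costs one sign for each smaller index,
  which is the sign in the product of the corresponding monomials in \<open>\<omega>\<close>; if \<open>A\<close> already
  occurs, \<open>\<eta> A\<close> meets itself and the product vanishes.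
\<close>

lemma eta_mult_list:
  "sorted xs \<Longrightarrow> distinct xs \<Longrightarrow> \<eta> A * prod_list (map \<eta> xs) =
    (if A \<in> set xs then 0
     else (-1) ^ card {t \<in> set xs. t < A} * prod_list (map \<eta> (insort A xs)))"
proof (induction xs)
  case (Cons x xs)
  have sq: "\<eta> x * \<eta> x = 0"
  proof -
    have "2 * (\<eta> x * \<eta> x) = 0" using anticommuting[of x x]
      by (simp add: mult_2 eq_neg_iff_add_eq_0)
    then have "cst 2 * (\<eta> x * \<eta> x) = 0"
      using cst_of_nat[where 'a = 'n, of 2] by simp
    moreover have "coef (cst 2 * (\<eta> x * \<eta> x)) e S = 2 * coef (\<eta> x * \<eta> x) e S" for e S
      by (rule coef_cst_mult)
    ultimately show ?thesis
      by (intro sgpoly_eqI) simp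
  qed
  have swap: "\<eta> A * (\<eta> x * w) = - (\<eta> x * (\<eta> A * w))" for w
    using anticommuting[of A x] by (simp flip: mult.assoc)
  consider "A = x" | "A < x" | "x < A" by (metis linorder_less_linear)
  then show ?case
  proof cases
    case 1
    then show ?thesis by (simp add: sq flip: mult.assoc)
  next
    case 2
    then have "\<not> y < A" if "y \<in> set (x # xs)" for y
      using Cons.prems that by auto
    then have n: "A \<notin> set (x # xs)" and e: "{t \<in> set (x # xs). t < A} = {}"
      using Cons.prems 2 by force+
    show ?thesis
      unfolding e using n 2 by (simp add: insort_is_Cons less_imp_le)
  next
    case 3
    have IH: "\<eta> A * prod_list (map \<eta> xs) =
      (if A \<in> set xs then 0
       else (-1) ^ card {t \<in> set xs. t < A} * prod_list (map \<eta> (insort A xs)))"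
      using Cons by simp
    show ?thesis
    proof (cases "A \<in> set xs")
      case True
      then show ?thesis using IH by (simp add: swap)
    next
      case False
      have "{t \<in> set (x # xs). t < A} = insert x {t \<in> set xs. t < A}"
        using 3 by auto
      then have c: "card {t \<in> set (x # xs). t < A} = Suc (card {t \<in> set xs. t < A})"
        using Cons.prems by simp
      have m: "\<eta> x * ((-1) ^ m * w) = (-1) ^ m * (\<eta> x * w)" for m w
        by (cases "even m") simp_all
      have n: "A \<notin> set (x # xs)" "\<not> A \<le> x" using 3 False by auto
      show ?thesis
        using n IH False by (simp add: swap c m del: list.set)
    qed
  qed
qed simp

lemma eta_mult_anti_monomial:
  "\<eta> A * anti_monomial \<eta> S =
    (if A \<in> S then 0 else cst (gsign {A} S) * anti_monomial \<eta> (insert A S))"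
proof -
  have "card {(s, t). s \<in> {A} \<and> t \<in> S \<and> t < s} = card (Pair A ` {t \<in> S. t < A})"
    by (rule arg_cong[where f = card]) auto
  also have "\<dots> = card {t \<in> S. t < A}"
    by (rule card_image) (auto simp: inj_on_def)
  finally have "(cst (gsign {A} S) :: 'n sgpoly) = (-1) ^ card {t \<in> S. t < A}"
    by (cases "even (card {t \<in> S. t < A})") (simp_all add: gsign_def cst_simps)
  moreover have "A \<notin> S \<Longrightarrow> sorted_list_of_set (insert A S) = insort A (sorted_list_of_set S)"
    by simp
  ultimately show ?thesis
    using eta_mult_list[of "sorted_list_of_set S" A]
    by (cases "A \<in> S") (simp_all add: anti_monomial_def)
qed

lemma substitute_omega_mult: "substitute \<sigma> \<eta> (omega A * v) = \<eta> A * substitute \<sigma> \<eta> v"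
proof (induction v rule: sgpoly_induct)
  case (cst_mult c v)
  then show ?case
    by (simp add: substitute_cst_mult cst_left_commute)
next
  case (monomial e S)
  obtain a b where e: "e = (a, b)" by force
  have 1: "\<eta> A * (\<sigma> 0 ^ a * \<sigma> 1 ^ b * w) = \<sigma> 0 ^ a * \<sigma> 1 ^ b * (\<eta> A * w)" for w
    using central_powers[of a b "\<eta> A"] by (simp flip: mult.assoc)
  show ?case
    by (simp add: e omega_mult_monomial substitute_monomial substitute_cst_mult substitute_0 1 cst_left_commute
        eta_mult_anti_monomial)
qed (simp_all add: distrib_left substitute_add substitute_0)

end

text \<open>
  Chain rule for a linear change \<open>\<sigma>\<close> of the commuting variables.
\<close>

lemma (in substitution) sderiv_substitute:
  assumes "\<And>A. sderiv A' (\<eta> A) = 0" "\<And>C'. sderiv A' (\<sigma> C') = cst (a C')"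
  shows "sderiv A' (substitute \<sigma> \<eta> v) = (\<Sum>C'\<in>UNIV. cst (a C') * substitute \<sigma> \<eta> (sderiv C' v))"
proof (induction v rule: sgpoly_induct)
  case (monomial e S)
  obtain x y where e: "e = (x, y)" by force
  have "sderiv A' (\<sigma> 0 ^ x * \<sigma> 1 ^ y * anti_monomial \<eta> S) =
     (of_nat x * \<sigma> 0 ^ (x - 1) * cst (a 0) * \<sigma> 1 ^ y +
      \<sigma> 0 ^ x * (of_nat y * \<sigma> 1 ^ (y - 1) * cst (a 1))) * anti_monomial \<eta> S"
    by (simp only: sderiv_mult sderiv_power[OF central] sderiv_anti_monomial[OF assms(1)] assms(2)
        mult_zero_right add_0_right)
  also have "\<dots> = cst (a 0) * (of_nat x * (\<sigma> 0 ^ (x - 1) * \<sigma> 1 ^ y * anti_monomial \<eta> S)) +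
     cst (a 1) * (of_nat y * (\<sigma> 0 ^ x * \<sigma> 1 ^ (y - 1) * anti_monomial \<eta> S))"
    by (simp only: distrib_right mult.assoc cst_left_commute)
      (simp only: of_nat_left_commute[of "\<sigma> 0 ^ x"])
  finally show ?case
    by (simp add: e sum_two sderiv_monomial substitute_of_nat_mult substitute_monomial)
next
  case (cst_mult c v)
  then show ?case
    by (simp add: sderiv_cst_mult substitute_cst_mult sum_distrib_left cst_left_commute[of "cst (a _)" c])
qed (simp_all add: sderiv_simps substitute_0 sderiv_add substitute_add distrib_left sum.distrib)


section \<open>Gradients in the complex coordinates\<close>

lemma sum_cindex:
  fixes F :: "'n::finite cindex \<Rightarrow> 'b::comm_monoid_add"
  shows "(\<Sum>A\<in>UNIV. F A) = (\<Sum>l\<in>UNIV. F (CIdx l 0) + F (CIdx l 1))"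
proof -
  have "(\<Sum>A\<in>UNIV. F A) = (\<Sum>(l, a)\<in>UNIV. F (CIdx l a))"
    by (rule sum.reindex_bij_witness[where i = "\<lambda>(l, a). CIdx l a" and j = "\<lambda>A. (blk A, pos A)"]) auto
  also have "\<dots> = (\<Sum>l\<in>UNIV. \<Sum>a\<in>UNIV. F (CIdx l a))"
    by (simp add: sum.cartesian_product flip: UNIV_Times_UNIV)
  finally show ?thesis by (simp add: sum_two)
qed

text \<open>
  The entries of the complex matrix of a quaternionic vector. Together they identify the
  complexified tangent space with complex \<open>2n \<times> 2\<close> matrices, and \<open>nabla A' A\<close> is the
  partial derivative with respect to the entry in row \<open>A\<close> and column \<open>A'\<close>.
\<close>

definition zcoord :: "'n::finite hspace \<Rightarrow> 'n cindex \<Rightarrow> 2 \<Rightarrow> complex" where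
  "zcoord v A A' = qtau (v $ blk A) $ pos A $ A'"

text \<open>
  Real differentiability, with the differential written in the coordinates \<open>zcoord\<close>. Every
  real-linear map to the complex numbers has unique coefficients of this kind, and by
  \<open>nabla_eq\<close> these coefficients are the \<open>nabla A' A \<phi> q\<close>.
\<close>

definition has_complex_gradient :: "('n::finite hspace \<Rightarrow> complex) \<Rightarrow> (2 \<Rightarrow> 'n cindex \<Rightarrow> complex) \<Rightarrow> 'n hspace \<Rightarrow> bool" where
  "has_complex_gradient \<phi> c q \<longleftrightarrow> (\<phi> has_derivative (\<lambda>v. \<Sum>A\<in>UNIV. \<Sum>A'\<in>UNIV. c A' A * zcoord v A A')) (at q)"

lemma pderiv_dir_eq:
  assumes "(\<phi> has_derivative L) (at q)"
  shows "pderiv_dir l u \<phi> q = L (axis l u)"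
proof -
  have "((\<lambda>t. \<phi> (q + t *\<^sub>R axis l u)) has_derivative (\<lambda>t. L (t *\<^sub>R axis l u))) (at 0)"
    by (rule has_derivative_compose[where g = \<phi> and f = "\<lambda>t::real. q + t *\<^sub>R axis l u"])
      (auto intro!: derivative_eq_intros assms)
  then have "((\<lambda>t. \<phi> (q + t *\<^sub>R axis l u)) has_vector_derivative L (axis l u)) (at 0)"
    using assms by (simp add: has_vector_derivative_def has_derivative_def linear_simps)
  then show ?thesis
    unfolding pderiv_dir_def by (rule vector_derivative_at)
qed

lemma zcoord_sum_axis:
  "(\<Sum>A\<in>UNIV. \<Sum>A'\<in>UNIV. c A' A * zcoord (axis l u) A A') =
    (\<Sum>a\<in>UNIV. \<Sum>A'\<in>UNIV. c A' (CIdx l a) * qtau u $ a $ A')"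
proof -
  have z: "qtau 0 $ a $ A' = 0" for a A'
    using two_cases[of a] two_cases[of A'] by (auto simp: qtau_entries)
  have "(\<Sum>A\<in>UNIV. \<Sum>A'\<in>UNIV. c A' A * zcoord (axis l u) A A') =
    (\<Sum>m\<in>UNIV. if m = l then \<Sum>a\<in>UNIV. \<Sum>A'\<in>UNIV. c A' (CIdx l a) * qtau u $ a $ A' else 0)"
    unfolding sum_cindex
    by (intro sum.cong refl) (auto simp: zcoord_def axis_def z sum_two)
  then show ?thesis by simp
qed

lemma nabla_eq:
  assumes "has_complex_gradient \<phi> c q"
  shows "nabla A' A \<phi> q = c A' A"
proof -
  note d = assms[unfolded has_complex_gradient_def]
  obtain l a where A: "A = CIdx l a" by (cases A)
  have "A' = 0 \<or> A' = 1" "a = 0 \<or> a = 1" using two_cases by blast+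
  then show ?thesis
    unfolding A nabla_def pderiv_dir_eq[OF d] zcoord_sum_axis
    by (elim disjE; simp add: sum_two qtau_entries algebra_simps)
qed

text \<open>
  Differentiability suffices: expand a vector over the four real directions of each
  quaternionic coordinate; the directional derivatives recombine because \<open>nabla\<close> is dual to
  \<open>zcoord\<close>.
\<close>

lemma has_complex_gradient_nabla:
  fixes q :: "'n::finite hspace"
  assumes "\<phi> differentiable (at q)"
  shows "has_complex_gradient \<phi> (\<lambda>A' A. nabla A' A \<phi> q) q"
proof -
  obtain L where L: "(\<phi> has_derivative L) (at q)"
    using assms by (auto simp: differentiable_def)
  interpret L: linear L using L by (rule has_derivative_linear)
  have "L v = (\<Sum>A\<in>UNIV. \<Sum>A'\<in>UNIV. nabla A' A \<phi> q * zcoord v A A')" for v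
  proof -
    have q: "x = q0 x *\<^sub>R 1 + q1 x *\<^sub>R qI + q2 x *\<^sub>R qJ + q3 x *\<^sub>R qK" for x
      by (simp add: quat_eq_iff)
    have ax: "axis l x = q0 x *\<^sub>R axis l 1 + q1 x *\<^sub>R axis l qI + q2 x *\<^sub>R axis l qJ + q3 x *\<^sub>R axis l qK"
      for l :: 'n and x
      by (subst (1) q) (simp add: vec_eq_iff axis_def)
    have Lax: "L (axis l x) = of_real (q0 x) * L (axis l 1) + of_real (q1 x) * L (axis l qI) +
        of_real (q2 x) * L (axis l qJ) + of_real (q3 x) * L (axis l qK)" for l :: 'n and x
      by (subst ax) (simp only: L.add L.scale, simp only: scaleR_conv_of_real)
    have "v = (\<Sum>l\<in>UNIV. axis l (v $ l))"
      by (simp add: vec_eq_iff axis_def if_distrib cong: if_cong)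
    then have "L v = (\<Sum>l\<in>UNIV. L (axis l (v $ l)))"
      using L.sum by metis
    also have "\<dots> = (\<Sum>A\<in>UNIV. \<Sum>A'\<in>UNIV. nabla A' A \<phi> q * zcoord v A A')"
      unfolding sum_cindex
      by (intro sum.cong refl, subst Lax)
        (simp add: sum_two nabla_def zcoord_def qtau_entries pderiv_dir_eq[OF L] field_simps)
    finally show ?thesis .
  qed
  then have "L = (\<lambda>v. \<Sum>A\<in>UNIV. \<Sum>A'\<in>UNIV. nabla A' A \<phi> q * zcoord v A A')" ..
  with L show ?thesis by (simp add: has_complex_gradient_def)
qed

lemma has_complex_gradient_const: "has_complex_gradient (\<lambda>_. a) (\<lambda>_ _. 0) q"
  by (simp add: has_complex_gradient_def)

lemma has_complex_gradient_add:
  "has_complex_gradient \<phi> c q \<Longrightarrow> has_complex_gradient \<psi> d q \<Longrightarrow> has_complex_gradient (\<lambda>p. \<phi> p + \<psi> p) (\<lambda>A' A. c A' A + d A' A) q"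
  unfolding has_complex_gradient_def
  by (drule (1) has_derivative_add) (simp add: sum.distrib distrib_right)

lemma has_complex_gradient_mult:
  assumes "has_complex_gradient \<phi> c q" "has_complex_gradient \<psi> d q"
  shows "has_complex_gradient (\<lambda>p. \<phi> p * \<psi> p) (\<lambda>A' A. \<phi> q * d A' A + c A' A * \<psi> q) q"
proof -
  have "(\<phi> q * d A' A + c A' A * \<psi> q) * zcoord v A A' =
      \<phi> q * (d A' A * zcoord v A A') + c A' A * zcoord v A A' * \<psi> q" for v A A'
    by (simp add: algebra_simps)
  then have "(\<lambda>v. \<Sum>A\<in>UNIV. \<Sum>A'\<in>UNIV. (\<phi> q * d A' A + c A' A * \<psi> q) * zcoord v A A') =
      (\<lambda>v. \<phi> q * (\<Sum>A\<in>UNIV. \<Sum>A'\<in>UNIV. d A' A * zcoord v A A') +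
        (\<Sum>A\<in>UNIV. \<Sum>A'\<in>UNIV. c A' A * zcoord v A A') * \<psi> q)"
    by (simp only: sum.distrib sum_distrib_left sum_distrib_right)
  then show ?thesis
    using has_derivative_mult[OF assms[unfolded has_complex_gradient_def]]
    by (simp only: has_complex_gradient_def)
qed

lemma has_complex_gradient_sum:
  assumes "\<And>i. i \<in> I \<Longrightarrow> has_complex_gradient (\<phi> i) (c i) q"
  shows "has_complex_gradient (\<lambda>p. \<Sum>i\<in>I. \<phi> i p) (\<lambda>A' A. \<Sum>i\<in>I. c i A' A) q"
  using assms
  by (induction I rule: infinite_finite_induct) (simp_all add: has_complex_gradient_const has_complex_gradient_add)

lemma has_complex_gradient_mult_const:
  "has_complex_gradient \<phi> c q \<Longrightarrow> has_complex_gradient (\<lambda>p. \<phi> p * a) (\<lambda>A' A. c A' A * a) q"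
  using has_complex_gradient_mult[OF _ has_complex_gradient_const, of \<phi> c q a] by simp

lemma has_complex_gradient_cong:
  assumes "has_complex_gradient \<phi> c q" "\<forall>\<^sub>F p in nhds q. \<psi> p = \<phi> p"
  shows "has_complex_gradient \<psi> c q"
proof -
  have "\<forall>\<^sub>F p in at q. \<phi> p = \<psi> p" "\<phi> q = \<psi> q"
    using assms(2) eventually_nhds_x_imp_x[OF assms(2)]
    by (auto simp: eventually_at_filter elim: eventually_mono)
  then show ?thesis
    using assms(1) unfolding has_complex_gradient_def
    by (elim has_derivative_transform_eventually) auto
qed


section \<open>The operators \<open>d\<^sup>A\<^sup>'\<close> on polynomial-valued functions\<close>

text \<open>
  The polynomials form an infinite-dimensional space without a norm, so differentiability is
  expressed algebraically: near \<open>q\<close> the function is a finite sum of differentiable scalar functions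
  times fixed polynomials. The Leibniz rule then only needs the product rule for scalar
  functions, and finiteness of supports is automatic.
\<close>

inductive has_poly_gradient :: "'n::{finite,linorder} hspace \<Rightarrow> ('n hspace \<Rightarrow> 'n sgpoly) \<Rightarrow> (2 \<Rightarrow> 'n cindex \<Rightarrow> 'n sgpoly) \<Rightarrow> bool"
  for q where
  scalar_mult: "has_complex_gradient \<phi> c q \<Longrightarrow> has_poly_gradient q (\<lambda>p. cst (\<phi> p) * M) (\<lambda>A' A. cst (c A' A) * M)"
| add: "has_poly_gradient q F G \<Longrightarrow> has_poly_gradient q F' G' \<Longrightarrow> has_poly_gradient q (\<lambda>p. F p + F' p) (\<lambda>A' A. G A' A + G' A' A)"
| cong: "has_poly_gradient q F G \<Longrightarrow> \<forall>\<^sub>F p in nhds q. F' p = F p \<Longrightarrow> has_poly_gradient q F' G"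

lemma has_poly_gradient_sum:
  assumes "\<And>i. i \<in> I \<Longrightarrow> has_poly_gradient q (F i) (G i)"
  shows "has_poly_gradient q (\<lambda>p. \<Sum>i\<in>I. F i p) (\<lambda>A' A. \<Sum>i\<in>I. G i A' A)"
proof -
  have "has_poly_gradient q (\<lambda>p. 0) (\<lambda>A' A. 0)"
    using has_poly_gradient.scalar_mult[OF has_complex_gradient_const, of q 1 0] by simp
  then show ?thesis
    using assms by (induction I rule: infinite_finite_induct) (simp_all add: has_poly_gradient.add)
qed

lemma has_poly_gradient_coef:
  "has_poly_gradient q F G \<Longrightarrow> has_complex_gradient (\<lambda>p. coef (F p) e S) (\<lambda>A' A. coef (G A' A) e S) q"
proof (induction rule: has_poly_gradient.induct)
  case (scalar_mult \<phi> c M)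
  show ?case
    using has_complex_gradient_mult[OF scalar_mult has_complex_gradient_const, of "coef M e S"]
    by (simp add: coef_cst_mult)
next
  case (add F G F' G')
  then show ?case by (simp add: has_complex_gradient_add)
next
  case (cong F G F')
  show ?case
    by (rule has_complex_gradient_cong[OF cong.IH]) (use cong.hyps in \<open>auto elim: eventually_mono\<close>)
qed

text \<open>
  The coefficientwise gradient is by definition the lookup function of an actual polynomial, so
  \<open>Abs_poly_mapping\<close> is applied within its domain.
\<close>

lemma nabla_coef_eq:
  assumes "has_poly_gradient q F G"
  shows "nabla_coef A' A F q = G A' A"
proof -
  have "(\<lambda>e. Grassmann (\<lambda>S. nabla A' A (\<lambda>p. coef (F p) e S) q)) = Poly_Mapping.lookup (G A' A)"
    by (intro ext grassmann_eqI) (simp add: nabla_eq[OF has_poly_gradient_coef[OF assms]], simp add: coef_def)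
  then show ?thesis by (simp add: nabla_coef_def lookup_inverse)
qed

lemma has_poly_gradient_mult:
  assumes "has_poly_gradient q F G" "has_poly_gradient q F' G'"
  shows "has_poly_gradient q (\<lambda>p. F p * F' p) (\<lambda>A' A. G A' A * F' q + F q * G' A' A)"
  using assms(1)
proof (induction rule: has_poly_gradient.induct)
  case (scalar_mult \<phi> c M)
  note \<phi> = this
  show ?case using assms(2)
  proof (induction rule: has_poly_gradient.induct)
    case (scalar_mult \<psi> d N)
    show ?case
      using has_poly_gradient.scalar_mult[OF has_complex_gradient_mult[OF \<phi> scalar_mult], of "M * N"]
      by (simp add: cst_simps mult.assoc cst_left_commute[of M] distrib_right add.commute)
  next
    case (add F G F' G')
    show ?case
      using has_poly_gradient.add[OF add.IH] by (simp add: algebra_simps)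
  next
    case (cong F G F')
    then have "F' q = F q" by (auto dest: eventually_nhds_x_imp_x)
    with cong.IH show ?case
      by (simp, elim has_poly_gradient.cong) (use cong.hyps in \<open>auto elim: eventually_mono\<close>)
  qed
next
  case (add F1 G1 F2 G2)
  show ?case
    using has_poly_gradient.add[OF add.IH] by (simp add: algebra_simps)
next
  case (cong F1 G1 F2)
  then have "F2 q = F1 q" by (auto dest: eventually_nhds_x_imp_x)
  with cong.IH show ?case
    by (simp, elim has_poly_gradient.cong) (use cong.hyps in \<open>auto elim: eventually_mono\<close>)
qed

text \<open>
  Both operators \<open>d\<^sup>0\<close>, \<open>d\<^sup>1\<close> at once; the relation carries differentiability along, which the
  function \<open>d_op\<close> does not.
\<close>

definition has_d_op :: "('n::{finite,linorder} hspace \<Rightarrow> 'n sgpoly) \<Rightarrow> (2 \<Rightarrow> 'n sgpoly) \<Rightarrow> 'n hspace \<Rightarrow> bool" where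
  "has_d_op F D q \<longleftrightarrow> (\<exists>G. has_poly_gradient q F G \<and> D = (\<lambda>A'. \<Sum>A\<in>UNIV. omega A * G A' A))"

lemma d_op_eq: "has_d_op F D q \<Longrightarrow> d_op A' F q = D A'"
  by (auto simp: has_d_op_def d_op_def nabla_coef_eq)

lemma has_d_op_const: "has_d_op (\<lambda>_. v) (\<lambda>_. 0) q"
proof -
  have "has_poly_gradient q (\<lambda>p. v) (\<lambda>A' A. 0)"
    using has_poly_gradient.scalar_mult[OF has_complex_gradient_const, of q 1 v] by (simp add: cst_simps)
  then show ?thesis
    unfolding has_d_op_def by (intro exI conjI, assumption) simp
qed

lemma has_d_op_add:
  assumes "has_d_op F D q" "has_d_op F' D' q"
  shows "has_d_op (\<lambda>p. F p + F' p) (\<lambda>A'. D A' + D' A') q"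
proof -
  from assms obtain G G' where G: "has_poly_gradient q F G" "has_poly_gradient q F' G'"
    "D = (\<lambda>A'. \<Sum>A\<in>UNIV. omega A * G A' A)" "D' = (\<lambda>A'. \<Sum>A\<in>UNIV. omega A * G' A' A)"
    unfolding has_d_op_def by blast
  show ?thesis unfolding has_d_op_def
    by (intro exI conjI, rule has_poly_gradient.add[OF G(1,2)]) (simp add: G(3,4) distrib_left sum.distrib)
qed

lemma has_d_op_sum:
  assumes "\<And>i. i \<in> I \<Longrightarrow> has_d_op (F i) (D i) q"
  shows "has_d_op (\<lambda>p. \<Sum>i\<in>I. F i p) (\<lambda>A'. \<Sum>i\<in>I. D i A') q"
  using assms
  by (induction I rule: infinite_finite_induct) (simp_all add: has_d_op_const has_d_op_add)

lemma has_d_op_cong: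
  assumes "has_d_op F D q" "\<forall>\<^sub>F p in nhds q. F' p = F p"
  shows "has_d_op F' D q"
  using assms has_poly_gradient.cong unfolding has_d_op_def by blast

text \<open>
  The operators are antiderivations. It is enough that the value of the left factor at \<open>q\<close>
  commutes (or, in the odd case, anticommutes) with the generators, because only that value is
  crossed by \<open>\<omega>\<^sup>A\<close>.
\<close>

lemma has_d_op_mult_even:
  assumes "has_d_op F D q" "has_d_op F' D' q" "\<And>A. omega A * F q = F q * omega A"
  shows "has_d_op (\<lambda>p. F p * F' p) (\<lambda>A'. D A' * F' q + F q * D' A') q"
proof -
  from assms obtain G G' where G: "has_poly_gradient q F G" "has_poly_gradient q F' G'"
    "D = (\<lambda>A'. \<Sum>A\<in>UNIV. omega A * G A' A)" "D' = (\<lambda>A'. \<Sum>A\<in>UNIV. omega A * G' A' A)"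
    unfolding has_d_op_def by blast
  have *: "omega A * (F q * w) = F q * (omega A * w)" for A w
    using assms(3)[of A] by (simp flip: mult.assoc)
  show ?thesis unfolding has_d_op_def
    by (intro exI conjI, rule has_poly_gradient_mult[OF G(1,2)])
      (simp add: * G(3,4) distrib_left sum.distrib sum_distrib_left sum_distrib_right mult.assoc)
qed

lemma has_d_op_mult_odd:
  assumes "has_d_op F D q" "has_d_op F' D' q" "\<And>A. omega A * F q = - (F q * omega A)"
  shows "has_d_op (\<lambda>p. F p * F' p) (\<lambda>A'. D A' * F' q - F q * D' A') q"
proof -
  from assms obtain G G' where G: "has_poly_gradient q F G" "has_poly_gradient q F' G'"
    "D = (\<lambda>A'. \<Sum>A\<in>UNIV. omega A * G A' A)" "D' = (\<lambda>A'. \<Sum>A\<in>UNIV. omega A * G' A' A)"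
    unfolding has_d_op_def by blast
  have *: "omega A * (F q * w) = - (F q * (omega A * w))" for A w
    using assms(3)[of A] by (simp flip: mult.assoc)
  show ?thesis unfolding has_d_op_def
    by (intro exI conjI, rule has_poly_gradient_mult[OF G(1,2)])
      (simp add: * G(3,4) distrib_left sum.distrib sum_distrib_left sum_distrib_right mult.assoc
        sum_subtractf)
qed


section \<open>Derivatives of the fractional linear action and its cocycles\<close>

definition tau_b :: "quat^('n::finite option)^('n option) \<Rightarrow> 2 \<Rightarrow> 'n cindex \<Rightarrow> complex" where
  "tau_b h A' A = qtau (blk_b h $ blk A) $ A' $ pos A"

text \<open>
  The matrix \<open>P\<close> of the inverse of \<open>J1\<close>.
\<close>

definition inv_tau :: "quat^('n::finite option)^('n option) \<Rightarrow> 'n hspace \<Rightarrow> 2 \<Rightarrow> 2 \<Rightarrow> complex" where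
  "inv_tau h q A' B' = qtau (inverse (J1 h q)) $ A' $ B'"

text \<open>
  The components of \<open>J1\<^sup>-\<^sup>1 b\<close>, the logarithmic derivative of \<open>J1\<close>.
\<close>

definition J1_log_deriv :: "quat^('n::finite option)^('n option) \<Rightarrow> 'n hspace \<Rightarrow> 2 \<Rightarrow> 'n cindex \<Rightarrow> complex" where
  "J1_log_deriv h q A' A = (\<Sum>B'\<in>UNIV. inv_tau h q A' B' * tau_b h B' A)"

lemma zcoord_mult_left:
  "qtau (\<Sum>m\<in>UNIV. x m * v $ m) $ i $ j = (\<Sum>A\<in>UNIV. qtau (x (blk A)) $ i $ pos A * zcoord v A j)"
  unfolding sum_cindex
  by (simp add: qtau_sum qtau_mult sum_two zcoord_def)

lemma has_derivative_J1: "(J1 h has_derivative (\<lambda>v. \<Sum>m\<in>UNIV. blk_b h $ m * v $ m)) (at q)"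
proof -
  have "((\<lambda>q. blk_a h + (\<Sum>m\<in>UNIV. blk_b h $ m * q $ m)) has_derivative
      (\<lambda>v. 0 + (\<Sum>m\<in>UNIV. blk_b h $ m * v $ m))) (at q)"
    by (intro has_derivative_add has_derivative_const has_derivative_sum
        has_derivative_mult_right bounded_linear_imp_has_derivative bounded_linear_vec_nth)
  then show ?thesis by (simp add: J1_def[abs_def])
qed

text \<open>
  Quotient rule in the noncommutative setting:
  \<open>(d v) J1\<^sup>-\<^sup>1 - (c + d q) J1\<^sup>-\<^sup>1 (b v) J1\<^sup>-\<^sup>1 = (d - \<Phi>(q) b) v J1\<^sup>-\<^sup>1\<close>, and the last bracket
  is \<open>J2\<close>.
\<close>

lemma has_derivative_frac_act:
  assumes "J1 h q \<noteq> 0"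
  shows "(frac_act h has_derivative
    (\<lambda>v. \<chi> l. (\<Sum>m\<in>UNIV. J2 h q $ l $ m * v $ m) * inverse (J1 h q))) (at q)"
proof -
  let ?i = "inverse (J1 h q)"
  have "((\<lambda>q. (blk_c h $ l + (\<Sum>m\<in>UNIV. blk_d h $ l $ m * q $ m)) * inverse (J1 h q)) has_derivative
      (\<lambda>v. (\<Sum>m\<in>UNIV. J2 h q $ l $ m * v $ m) * ?i)) (at q)" for l
  proof -
    let ?n = "blk_c h $ l + (\<Sum>m\<in>UNIV. blk_d h $ l $ m * q $ m)"
    have 1: "((\<lambda>q. blk_c h $ l + (\<Sum>m\<in>UNIV. blk_d h $ l $ m * q $ m)) has_derivative
        (\<lambda>v. 0 + (\<Sum>m\<in>UNIV. blk_d h $ l $ m * v $ m))) (at q)"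
      by (intro has_derivative_add has_derivative_const has_derivative_sum
          has_derivative_mult_right bounded_linear_imp_has_derivative bounded_linear_vec_nth)
    have 2: "((\<lambda>q. inverse (J1 h q)) has_derivative
        (\<lambda>v. - (?i * (\<Sum>m\<in>UNIV. blk_b h $ m * v $ m) * ?i))) (at q)"
      by (rule Deriv.has_derivative_inverse[OF assms has_derivative_J1])
    have "?n * - (?i * (\<Sum>m\<in>UNIV. blk_b h $ m * v $ m) * ?i) + (0 + (\<Sum>m\<in>UNIV. blk_d h $ l $ m * v $ m)) * ?i
      = (\<Sum>m\<in>UNIV. J2 h q $ l $ m * v $ m) * ?i" for v
    proof -
      have "(\<Sum>m\<in>UNIV. J2 h q $ l $ m * v $ m) =
          (\<Sum>m\<in>UNIV. blk_d h $ l $ m * v $ m) - ?n * ?i * (\<Sum>m\<in>UNIV. blk_b h $ m * v $ m)"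
        by (simp add: J2_def frac_act_def matrix_vector_mult_def left_diff_distrib sum_subtractf
            sum_distrib_left mult.assoc)
      moreover have "n * - (i * S * i) + (0 + D) * i = (D - n * i * S) * i" for n i S D :: quat
        by (simp add: algebra_simps)
      ultimately show ?thesis by (simp only:)
    qed
    then show ?thesis
      using has_derivative_mult[OF 1 2] by simp
  qed
  note d = this
  have "((\<lambda>p. inner (frac_act h p) (axis l u)) has_derivative
      (\<lambda>v. inner (\<chi> l. (\<Sum>m\<in>UNIV. J2 h q $ l $ m * v $ m) * inverse (J1 h q)) (axis l u))) (at q)" for l u
    using has_derivative_inner_left[OF d, of l u]
    by (simp add: inner_axis frac_act_def matrix_vector_mult_def)
  then show ?thesis
    by (subst has_derivative_componentwise_within) (auto simp: Basis_vec_def)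
qed

lemma zcoord_frac_derivative:
  "zcoord (\<chi> l. (\<Sum>m\<in>UNIV. J2 h q $ l $ m * v $ m) * inverse (J1 h q)) B B' =
    (\<Sum>A\<in>UNIV. \<Sum>A'\<in>UNIV. (tau (J2 h q) $ B $ A * inv_tau h q A' B') * zcoord v A A')"
proof -
  have "zcoord (\<chi> l. (\<Sum>m\<in>UNIV. J2 h q $ l $ m * v $ m) * inverse (J1 h q)) B B' =
      qtau ((\<Sum>m\<in>UNIV. J2 h q $ blk B $ m * v $ m) * inverse (J1 h q)) $ pos B $ B'"
    by (simp only: zcoord_def vec_lambda_beta)
  also have "\<dots> = (\<Sum>A\<in>UNIV. \<Sum>A'\<in>UNIV. (tau (J2 h q) $ B $ A * inv_tau h q A' B') * zcoord v A A')"
    by (simp only: qtau_mult zcoord_mult_left)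
      (simp add: tau_def inv_tau_def sum_two sum.distrib sum_distrib_right sum_distrib_left mult_ac)
  finally show ?thesis .
qed

text \<open>
  Since \<open>\<tau>\<close> is multiplicative, the differential of the action multiplies the matrix of
  coordinates by \<open>\<tau>(J2)\<close> from the left and by \<open>P\<close> from the right; the gradient transforms with
  the transposed map.
\<close>

lemma has_complex_gradient_compose_frac_act:
  assumes "J1 h q \<noteq> 0" "has_complex_gradient \<phi> c (frac_act h q)"
  shows "has_complex_gradient (\<lambda>p. \<phi> (frac_act h p))
    (\<lambda>A' A. \<Sum>B\<in>UNIV. \<Sum>B'\<in>UNIV. c B' B * (tau (J2 h q) $ B $ A * inv_tau h q A' B')) q"
proof -
  have "(\<Sum>B\<in>UNIV. \<Sum>B'\<in>UNIV. c B' B *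
      (\<Sum>A\<in>UNIV. \<Sum>A'\<in>UNIV. (tau (J2 h q) $ B $ A * inv_tau h q A' B') * zcoord v A A')) =
    (\<Sum>A\<in>UNIV. \<Sum>A'\<in>UNIV. (\<Sum>B\<in>UNIV. \<Sum>B'\<in>UNIV. c B' B * (tau (J2 h q) $ B $ A * inv_tau h q A' B')) * zcoord v A A')"
    for v
  proof -
    have "(\<Sum>B\<in>UNIV. \<Sum>B'\<in>UNIV. c B' B *
      (\<Sum>A\<in>UNIV. \<Sum>A'\<in>UNIV. (tau (J2 h q) $ B $ A * inv_tau h q A' B') * zcoord v A A')) =
     (\<Sum>B\<in>UNIV. \<Sum>A\<in>UNIV. \<Sum>B'\<in>UNIV. \<Sum>A'\<in>UNIV.
        c B' B * (tau (J2 h q) $ B $ A * inv_tau h q A' B') * zcoord v A A')"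
      by (subst sum.swap) (simp add: sum_distrib_left mult.assoc)
    also have "\<dots> = (\<Sum>A\<in>UNIV. \<Sum>B\<in>UNIV. \<Sum>A'\<in>UNIV. \<Sum>B'\<in>UNIV.
        c B' B * (tau (J2 h q) $ B $ A * inv_tau h q A' B') * zcoord v A A')"
      by (subst sum.swap, subst (3) sum.swap, rule refl)
    also have "\<dots> = (\<Sum>A\<in>UNIV. \<Sum>A'\<in>UNIV. \<Sum>B\<in>UNIV. \<Sum>B'\<in>UNIV.
        c B' B * (tau (J2 h q) $ B $ A * inv_tau h q A' B') * zcoord v A A')"
      by (subst (2) sum.swap, rule refl)
    finally show ?thesis by (simp only: sum_distrib_right)
  qed
  then show ?thesis
    using has_derivative_compose[OF has_derivative_frac_act[OF assms(1)] assms(2)[unfolded has_complex_gradient_def]]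
    unfolding has_complex_gradient_def zcoord_frac_derivative by simp
qed

lemma has_complex_gradient_zcoord_frac_act:
  assumes "J1 h q \<noteq> 0"
  shows "has_complex_gradient (\<lambda>p. zcoord (frac_act h p) B B') (\<lambda>A' A. tau (J2 h q) $ B $ A * inv_tau h q A' B') q"
proof -
  have "((\<lambda>p. zcoord (frac_act h p) B B') has_derivative
    (\<lambda>v. zcoord (\<chi> l. (\<Sum>m\<in>UNIV. J2 h q $ l $ m * v $ m) * inverse (J1 h q)) B B')) (at q)"
    unfolding zcoord_def
    by (intro has_derivative_qtau bounded_linear.has_derivative[OF bounded_linear_vec_nth]
        has_derivative_frac_act assms)
  then show ?thesis by (simp only: has_complex_gradient_def zcoord_frac_derivative)
qed

lemma has_complex_gradient_J1:
  "has_complex_gradient (\<lambda>p. qtau (J1 h p) $ B' $ C') (\<lambda>A' A. if A' = C' then tau_b h B' A else 0) q"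
proof -
  have "(\<Sum>A'\<in>UNIV. (if A' = C' then x else 0) * F A') = x * F C'" for x and F :: "2 \<Rightarrow> complex"
    using two_cases[of C'] by (auto simp: sum_two)
  then show ?thesis
    using has_derivative_qtau[OF has_derivative_J1, of h B' C' q]
    by (simp add: has_complex_gradient_def zcoord_mult_left tau_b_def)
qed

lemma has_complex_gradient_inv_tau:
  assumes "J1 h q \<noteq> 0"
  shows "has_complex_gradient (\<lambda>p. inv_tau h p B' C') (\<lambda>A' A. - (J1_log_deriv h q B' A * inv_tau h q A' C')) q"
proof -
  let ?i = "inverse (J1 h q)"
  have 2: "((\<lambda>q. inverse (J1 h q)) has_derivative
      (\<lambda>v. - (?i * (\<Sum>m\<in>UNIV. blk_b h $ m * v $ m) * ?i))) (at q)"
    by (rule Deriv.has_derivative_inverse[OF assms has_derivative_J1])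
  have "qtau (- (?i * (\<Sum>m\<in>UNIV. blk_b h $ m * v $ m) * ?i)) $ B' $ C' =
    (\<Sum>A\<in>UNIV. \<Sum>A'\<in>UNIV. - (J1_log_deriv h q B' A * inv_tau h q A' C') * zcoord v A A')" for v
    by (simp only: qtau_linear_simps qtau_mult zcoord_mult_left)
      (simp add: J1_log_deriv_def tau_b_def inv_tau_def sum_two sum_distrib_left sum_distrib_right algebra_simps sum.distrib sum_negf sum_subtractf)
  then show ?thesis
    using has_derivative_qtau[OF 2, of B' C']
    by (simp add: has_complex_gradient_def inv_tau_def)
qed

lemma has_complex_gradient_J1_log_deriv:
  assumes "J1 h q \<noteq> 0"
  shows "has_complex_gradient (\<lambda>p. J1_log_deriv h p B' C) (\<lambda>A' A. - (J1_log_deriv h q B' A * J1_log_deriv h q A' C)) q"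
proof -
  have "has_complex_gradient (\<lambda>p. \<Sum>D'\<in>UNIV. inv_tau h p B' D' * tau_b h D' C)
    (\<lambda>A' A. \<Sum>D'\<in>UNIV. - (J1_log_deriv h q B' A * inv_tau h q A' D') * tau_b h D' C) q"
    by (intro has_complex_gradient_sum has_complex_gradient_mult_const has_complex_gradient_inv_tau assms)
  moreover have "(\<Sum>D'\<in>UNIV. - (x * inv_tau h q A' D') * tau_b h D' C) = - (x * J1_log_deriv h q A' C)" for x A'
    by (simp add: J1_log_deriv_def sum_distrib_left mult.assoc sum_negf)
  ultimately show ?thesis by (simp only: J1_log_deriv_def[of h _ B' C])
qed

text \<open>
  \<open>J2 = d - \<Phi> b\<close> depends on the point only through the action itself, so its gradient is again
  a product of \<open>J2\<close> with the logarithmic derivative of \<open>J1\<close>.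
\<close>

lemma has_complex_gradient_J2:
  assumes "J1 h q \<noteq> 0"
  shows "has_complex_gradient (\<lambda>p. tau (J2 h p) $ B $ C) (\<lambda>A' A. - (tau (J2 h q) $ B $ A * J1_log_deriv h q A' C)) q"
proof -
  have "tau (J2 h p) $ B $ C = tau (blk_d h) $ B $ C +
      (\<Sum>D'\<in>UNIV. zcoord (frac_act h p) B D' * (- tau_b h D' C))" for p
    by (simp add: tau_def J2_def qtau_linear_simps qtau_mult zcoord_def tau_b_def sum_negf)
  moreover have "has_complex_gradient (\<lambda>p. tau (blk_d h) $ B $ C +
      (\<Sum>D'\<in>UNIV. zcoord (frac_act h p) B D' * (- tau_b h D' C)))
    (\<lambda>A' A. 0 + (\<Sum>D'\<in>UNIV. tau (J2 h q) $ B $ A * inv_tau h q A' D' * (- tau_b h D' C))) q"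
    by (intro has_complex_gradient_add has_complex_gradient_const has_complex_gradient_sum has_complex_gradient_mult_const
        has_complex_gradient_zcoord_frac_act assms)
  moreover have "0 + (\<Sum>D'\<in>UNIV. x * inv_tau h q A' D' * (- tau_b h D' C)) = - (x * J1_log_deriv h q A' C)" for x A'
    by (simp add: J1_log_deriv_def sum_distrib_left mult.assoc sum_negf)
  ultimately show ?thesis by (simp only:)
qed

lemma det_inv_tau:
  "inv_tau h q 0 0 * inv_tau h q 1 1 - inv_tau h q 0 1 * inv_tau h q 1 0 =
    complex_of_real (1 / norm (J1 h q) ^ 2)"
  unfolding inv_tau_def det_qtau by (simp add: norm_inverse power_inverse divide_inverse)

text \<open>
  The norm is brought into the complex calculus as \<open>|J1|\<^sup>-\<^sup>2 = det P\<close>, whose gradient follows from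
  that of the entries of \<open>P\<close>; the other weights are powers of this one.
\<close>

lemma has_complex_gradient_norm_power:
  assumes "J1 h q \<noteq> 0"
  shows "has_complex_gradient (\<lambda>p. complex_of_real (1 / norm (J1 h p) ^ (2 * l)))
     (\<lambda>A' A. - (of_nat l * complex_of_real (1 / norm (J1 h q) ^ (2 * l)) * J1_log_deriv h q A' A)) q"
proof (induction l)
  case 0
  show ?case using has_complex_gradient_const[of 1] by simp
next
  case (Suc l)
  note i = has_complex_gradient_inv_tau[OF assms]
  have eq: "inv_tau h p 0 0 * inv_tau h p 1 1 + inv_tau h p 0 1 * inv_tau h p 1 0 * (- 1) =
      complex_of_real (1 / norm (J1 h p) ^ 2)" for p
    using det_inv_tau[of h p] by simp
  have "has_complex_gradient (\<lambda>p. complex_of_real (1 / norm (J1 h p) ^ 2))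
    (\<lambda>A' A. - (complex_of_real (1 / norm (J1 h q) ^ 2) * J1_log_deriv h q A' A)) q"
  proof -
    let ?G = "\<lambda>A' A. inv_tau h q 0 0 * - (J1_log_deriv h q 1 A * inv_tau h q A' 1) + - (J1_log_deriv h q 0 A * inv_tau h q A' 0) * inv_tau h q 1 1
      + (inv_tau h q 0 1 * - (J1_log_deriv h q 1 A * inv_tau h q A' 0) + - (J1_log_deriv h q 0 A * inv_tau h q A' 1) * inv_tau h q 1 0) * (- 1)"
    have "?G A' A = - (complex_of_real (1 / norm (J1 h q) ^ 2) * J1_log_deriv h q A' A)" for A' A
      unfolding det_inv_tau[symmetric] using two_cases[of A'] by (auto simp: algebra_simps)
    then have G: "?G = (\<lambda>A' A. - (complex_of_real (1 / norm (J1 h q) ^ 2) * J1_log_deriv h q A' A))"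
      by (intro ext)
    show ?thesis
      using has_complex_gradient_add[OF has_complex_gradient_mult[OF i i] has_complex_gradient_mult_const[OF has_complex_gradient_mult[OF i i]],
        of 0 0 1 1 0 1 1 0 "-1"]
      unfolding eq G .
  qed
  note m = has_complex_gradient_mult[OF this Suc]
  have n: "complex_of_real (1 / norm x ^ (2 * Suc l)) =
      complex_of_real (1 / norm x ^ 2) * complex_of_real (1 / norm x ^ (2 * l))" for x :: quat
    by (simp add: power2_eq_square)
  have "a * - (of_nat l * b * c) + - (a * c) * b = - (of_nat (Suc l) * (a * b) * c)" for a b c :: complex
    by (simp add: algebra_simps)
  with m show ?case by (simp only: n)
qed


section \<open>One-forms and the derivatives of the multipliers\<close>

definition one_form :: "('n cindex \<Rightarrow> complex) \<Rightarrow> 'n::{finite,linorder} sgpoly" where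
  "one_form c = (\<Sum>A\<in>UNIV. cst (c A) * omega A)"

lemma cst_omega_mult: "cst a * omega A * (cst b * omega B) = cst (a * b) * (omega A * omega B)"
  by (simp only: mult.assoc cst_simps cst_left_commute[of "omega A"])

lemma one_form_mult:
  "one_form c * one_form d = (\<Sum>A\<in>UNIV. \<Sum>B\<in>UNIV. cst (c A * d B) * (omega A * omega B))"
  unfolding one_form_def sum_distrib_left sum_distrib_right
  by (subst sum.swap) (simp only: cst_omega_mult)

lemma one_form_anticommute: "one_form c * one_form d = - (one_form d * one_form c)"
proof -
  have "one_form d * one_form c = (\<Sum>A\<in>UNIV. \<Sum>B\<in>UNIV. - (cst (c A * d B) * (omega A * omega B)))"
    unfolding one_form_mult
    by (subst sum.swap, intro sum.cong refl, subst omega_anticommute) (simp add: mult.commute)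
  then show ?thesis by (simp add: one_form_mult sum_negf)
qed

lemma one_form_minus: "one_form (\<lambda>A. - c A) = - one_form c"
  by (simp add: one_form_def cst_simps sum_negf)

lemma one_form_cst_mult: "one_form (\<lambda>A. a * c A) = cst a * one_form c"
  by (simp add: one_form_def cst_simps sum_distrib_left mult.assoc)

lemma omega_one_form: "omega A = one_form (\<lambda>B. if B = A then 1 else 0)"
proof -
  have "one_form (\<lambda>B. if B = A then 1 else 0) = (\<Sum>B\<in>UNIV. if B = A then omega A else 0)"
    unfolding one_form_def by (intro sum.cong) (auto simp: cst_simps)
  then show ?thesis by simp
qed

lemma omega_one_form_anticommute: "omega A * one_form c = - (one_form c * omega A)"
  unfolding omega_one_form[of A] by (rule one_form_anticommute)

lemma sderiv_one_form: "sderiv A' (one_form c) = 0"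
  by (simp add: one_form_def sderiv_sum sderiv_mult sderiv_simps)

lemma act_omega_one_form: "act_omega m B = one_form (\<lambda>A. tau m $ B $ A)"
  by (simp add: act_omega_def one_form_def)

lemma has_d_op_cst:
  assumes "has_complex_gradient \<phi> c q"
  shows "has_d_op (\<lambda>p. cst (\<phi> p)) (\<lambda>A'. one_form (c A')) q"
proof -
  have "has_poly_gradient q (\<lambda>p. cst (\<phi> p)) (\<lambda>A' A. cst (c A' A))"
    using has_poly_gradient.scalar_mult[OF assms, of 1] by simp
  then show ?thesis
    unfolding has_d_op_def by (intro exI conjI, assumption) (simp add: one_form_def cst_commute)
qed

lemma has_d_op_cst_mult:
  assumes "has_complex_gradient \<phi> c q" "has_d_op F D q"
  shows "has_d_op (\<lambda>p. cst (\<phi> p) * F p) (\<lambda>A'. one_form (c A') * F q + cst (\<phi> q) * D A') q"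
  by (rule has_d_op_mult_even[OF has_d_op_cst[OF assms(1)] assms(2)]) (simp add: cst_commute)

lemma has_d_op_cst_mult_const:
  assumes "has_complex_gradient \<phi> c q"
  shows "has_d_op (\<lambda>p. cst (\<phi> p) * v) (\<lambda>A'. one_form (c A') * v) q"
  using has_d_op_cst_mult[OF assms has_d_op_const[of v]] by simp

text \<open>
  Both \<open>\<beta>\<close> and \<open>\<eta>\<close> are one-forms whose coefficients have a gradient of the product shape
  assumed here. Contracted with the generators it gives \<open>- a b\<close> as a product of one-forms, which
  is \<open>b a\<close> by anticommutativity.
\<close>

lemma has_d_op_one_form:
  assumes "\<And>A. has_complex_gradient (\<lambda>p. c p A) (\<lambda>A' B. - (a B * b A' A)) q"
  shows "has_d_op (\<lambda>p. one_form (c p)) (\<lambda>A'. one_form (b A') * one_form a) q"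
proof -
  have "has_d_op (\<lambda>p. one_form (c p)) (\<lambda>A'. \<Sum>A\<in>UNIV. one_form (\<lambda>B. - (a B * b A' A)) * omega A) q"
    unfolding one_form_def[of "c _"]
    by (intro has_d_op_sum has_d_op_cst_mult_const assms)
  moreover have "(\<Sum>A\<in>UNIV. one_form (\<lambda>B. - (a B * b A' A)) * omega A) = one_form (b A') * one_form a" for A'
  proof -
    have "(\<Sum>A\<in>UNIV. one_form (\<lambda>B. - (a B * b A' A)) * omega A) =
        - (\<Sum>A\<in>UNIV. \<Sum>B\<in>UNIV. cst (a B * b A' A) * (omega B * omega A))"
      unfolding one_form_def
      by (simp add: sum_distrib_right cst_simps sum_negf mult.assoc)
    also have "\<dots> = - (one_form a * one_form (b A'))"
      unfolding one_form_mult by (subst sum.swap) (rule refl)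
    finally show ?thesis by (simp add: one_form_anticommute[of a])
  qed
  ultimately show ?thesis by simp
qed

text \<open>
  The one-forms \<open>\<beta>\<^sup>A\<^sup>'\<close> in which the derivatives of all multipliers are expressed.
\<close>

definition beta :: "quat^('n::{finite,linorder} option)^('n option) \<Rightarrow> 'n hspace \<Rightarrow> 2 \<Rightarrow> 'n sgpoly" where
  "beta h q A' = one_form (J1_log_deriv h q A')"

lemma has_d_op_beta:
  assumes "J1 h q \<noteq> 0"
  shows "has_d_op (\<lambda>p. beta h p B') (\<lambda>A'. beta h q A' * beta h q B') q"
  unfolding beta_def by (intro has_d_op_one_form has_complex_gradient_J1_log_deriv assms)

lemma has_d_op_act_omega:
  assumes "J1 h q \<noteq> 0"
  shows "has_d_op (\<lambda>p. act_omega (J2 h p) B) (\<lambda>A'. beta h q A' * act_omega (J2 h q) B) q"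
  unfolding beta_def act_omega_one_form by (intro has_d_op_one_form has_complex_gradient_J2 assms)

lemma has_d_op_inv_tau:
  assumes "J1 h q \<noteq> 0"
  shows "has_d_op (\<lambda>p. cst (inv_tau h p B' C')) (\<lambda>A'. - (cst (inv_tau h q A' C') * beta h q B')) q"
  using has_d_op_cst[OF has_complex_gradient_inv_tau[OF assms]]
  by (simp add: one_form_minus one_form_cst_mult beta_def mult.commute[of "J1_log_deriv _ _ _ _"])

lemma has_d_op_norm_power:
  assumes "J1 h q \<noteq> 0"
  shows "has_d_op (\<lambda>p. cst (complex_of_real (1 / norm (J1 h p) ^ (2 * l))))
    (\<lambda>A'. - (of_nat l * (cst (complex_of_real (1 / norm (J1 h q) ^ (2 * l))) * beta h q A'))) q"
  using has_d_op_cst[OF has_complex_gradient_norm_power[OF assms, of l]]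
  by (simp add: one_form_minus one_form_cst_mult beta_def cst_simps cst_of_nat mult.assoc del: of_real_divide)

text \<open>
  The pairing of the forms \<open>\<beta>\<close> with the commuting variables.
\<close>

definition theta :: "quat^('n::{finite,linorder} option)^('n option) \<Rightarrow> 'n hspace \<Rightarrow> 'n sgpoly" where
  "theta h q = (\<Sum>B'\<in>UNIV. beta h q B' * svar B')"

lemma has_d_op_act_s_lower:
  assumes "J1 h q \<noteq> 0"
  shows "has_d_op (\<lambda>p. act_s_lower (inverse (J1 h p)) C') (\<lambda>A'. - (cst (inv_tau h q A' C') * theta h q)) q"
proof -
  have "has_d_op (\<lambda>p. \<Sum>B'\<in>UNIV. cst (inv_tau h p B' C') * svar B')
    (\<lambda>A'. \<Sum>B'\<in>UNIV. one_form (\<lambda>A. - (J1_log_deriv h q B' A * inv_tau h q A' C')) * svar B') q"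
    by (intro has_d_op_sum has_d_op_cst_mult_const has_complex_gradient_inv_tau assms)
  moreover have "one_form (\<lambda>A. - (J1_log_deriv h q B' A * a)) = - (cst a * beta h q B')" for a B'
    by (simp add: one_form_minus one_form_cst_mult beta_def mult.commute[of "J1_log_deriv _ _ _ _"])
  ultimately show ?thesis
    by (simp add: act_s_lower_def inv_tau_def theta_def sum_negf sum_distrib_left mult.assoc)
qed

definition tau_b_form :: "quat^('n::{finite,linorder} option)^('n option) \<Rightarrow> 2 \<Rightarrow> 'n sgpoly" where
  "tau_b_form h A' = one_form (tau_b h A')"

lemma has_d_op_act_s_upper:
  "has_d_op (\<lambda>p. act_s_upper (J1 h p) C') (\<lambda>A'. svar A' * tau_b_form h C') q"
proof -
  have "has_d_op (\<lambda>p. \<Sum>B'\<in>UNIV. cst (qtau (J1 h p) $ C' $ B') * svar B')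
    (\<lambda>A'. \<Sum>B'\<in>UNIV. one_form (\<lambda>A. if A' = B' then tau_b h C' A else 0) * svar B') q"
    by (intro has_d_op_sum has_d_op_cst_mult_const has_complex_gradient_J1)
  moreover have "(\<Sum>B'\<in>UNIV. one_form (\<lambda>A. if A' = B' then tau_b h C' A else 0) * svar B') =
    svar A' * tau_b_form h C'" for A'
  proof -
    have "(\<Sum>B'\<in>UNIV. one_form (\<lambda>A. if A' = B' then tau_b h C' A else 0) * svar B') =
      (\<Sum>B'\<in>UNIV. if A' = B' then one_form (tau_b h C') * svar A' else 0)"
      by (intro sum.cong refl) (auto simp: one_form_def cst_simps)
    then show ?thesis by (simp add: tau_b_form_def svar_commute)
  qed
  ultimately show ?thesis by (simp add: act_s_upper_def)
qed


section \<open>The pullback formula\<close>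

text \<open>
  Moving \<open>d\<^sup>A\<^sup>'\<close> past a factor and moving the resulting \<open>b A'\<close> back to the front
  give one sign each, so every factor contributes the same term.
\<close>

lemma has_d_op_prod_list:
  assumes "\<And>B. has_d_op (\<lambda>p. \<eta> p B) (\<lambda>A'. b A' * \<eta> q B) q"
    and "\<And>A B. omega A * \<eta> q B = - (\<eta> q B * omega A)" "\<And>A' B. \<eta> q B * b A' = - (b A' * \<eta> q B)"
  shows "has_d_op (\<lambda>p. prod_list (map (\<eta> p) xs)) (\<lambda>A'. of_nat (length xs) * (b A' * prod_list (map (\<eta> q) xs))) q"
proof (induction xs)
  case Nil
  then show ?case using has_d_op_const[of 1] by simp
next
  case (Cons x xs)
  have "\<eta> q x * (of_nat m * (b A' * w)) = - (of_nat m * (b A' * (\<eta> q x * w)))" for m A' w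
  proof -
    have "\<eta> q x * (of_nat m * (b A' * w)) = of_nat m * (\<eta> q x * b A' * w)"
      by (simp only: of_nat_left_commute mult.assoc)
    then show ?thesis by (simp add: assms(3) mult.assoc)
  qed
  then show ?case
    using has_d_op_mult_odd[OF assms(1) Cons assms(2), of x]
    by (simp add: distrib_right mult.assoc)
qed

lemma has_d_op_power_even:
  assumes "has_d_op F D q" "\<And>v. F q * v = v * F q"
  shows "has_d_op (\<lambda>p. F p ^ m) (\<lambda>A'. of_nat m * (D A' * F q ^ (m - 1))) q"
proof (induction m)
  case 0
  then show ?case using has_d_op_const[of 1] by simp
next
  case (Suc m)
  have "F q * (of_nat m * (D A' * F q ^ (m - 1))) = of_nat m * (D A' * F q ^ m)" for A'
  proof (cases m)
    case (Suc k)
    have "F q * (of_nat m * (D A' * F q ^ k)) = of_nat m * (D A' * F q ^ k) * F q"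
      by (rule assms(2))
    then show ?thesis using Suc by (simp add: mult.assoc power_commutes)
  qed simp
  then show ?case
    using has_d_op_mult_even[OF assms(1) Suc assms(2)[symmetric]]
    by (simp add: distrib_right)
qed

text \<open>
  The transformed variables depend on the point. The locale treats the lower and the upper
  \<open>s\<close>-variables uniformly: \<open>X A' C'\<close> is the value of \<open>d\<^sup>A\<^sup>' \<sigma>\<^sub>C\<^sub>'\<close> at \<open>q\<close>, while \<open>\<eta>\<close> is given by
  the action of \<open>J2\<close> in both cases.
\<close>

locale substitution_family =
  fixes h :: "quat^('n::{finite,linorder} option)^('n option)" and \<sigma> :: "'n hspace \<Rightarrow> 2 \<Rightarrow> 'n sgpoly"
    and X :: "2 \<Rightarrow> 2 \<Rightarrow> 'n sgpoly" and q :: "'n hspace"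
  assumes J1: "J1 h q \<noteq> 0" and central: "\<And>p A' v. \<sigma> p A' * v = v * \<sigma> p A'"
    and has_d_op_\<sigma>: "\<And>C'. has_d_op (\<lambda>p. \<sigma> p C') (\<lambda>A'. X A' C') q"
begin

abbreviation \<eta> where "\<eta> p \<equiv> act_omega (J2 h p)"

sublocale substitution "\<sigma> p" "\<eta> p" for p
  by standard (rule central, unfold act_omega_one_form, rule one_form_anticommute)

abbreviation \<Psi> where "\<Psi> p \<equiv> substitute (\<sigma> p) (\<eta> p)"

text \<open>
  A fixed monomial still varies under the substitution: the Grassmann factors contribute
  \<open>card S\<close> times \<open>\<beta>\<close>, the commuting factors the chain rule with the inner derivatives \<open>X\<close>.
\<close>

lemma has_d_op_substitute_monomial:
  "has_d_op (\<lambda>p. \<Psi> p (monomial e S)) (\<lambda>A'. of_nat (card S) * (beta h q A' * \<Psi> q (monomial e S)) +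
    (\<Sum>C'\<in>UNIV. X A' C' * \<Psi> q (sderiv C' (monomial e S)))) q"
proof -
  obtain a b where e: "e = (a, b)" by force
  let ?s = "\<lambda>p. \<sigma> p 0 ^ a * \<sigma> p 1 ^ b"
  let ?m = "anti_monomial (\<eta> q) S"
  have "has_d_op (\<lambda>p. anti_monomial (\<eta> p) S)
      (\<lambda>A'. of_nat (length (sorted_list_of_set S)) * (beta h q A' * ?m)) q"
    unfolding anti_monomial_def
    by (rule has_d_op_prod_list[OF has_d_op_act_omega[OF J1]])
      (unfold act_omega_one_form beta_def, rule omega_one_form_anticommute, rule one_form_anticommute)
  then have \<eta>: "has_d_op (\<lambda>p. anti_monomial (\<eta> p) S) (\<lambda>A'. of_nat (card S) * (beta h q A' * ?m)) q"
    by simp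
  have \<sigma>: "has_d_op ?s (\<lambda>A'. of_nat a * (X A' 0 * \<sigma> q 0 ^ (a - 1)) * \<sigma> q 1 ^ b +
      \<sigma> q 0 ^ a * (of_nat b * (X A' 1 * \<sigma> q 1 ^ (b - 1)))) q"
    by (intro has_d_op_mult_even has_d_op_power_even has_d_op_\<sigma> central central_power[symmetric])
  have "has_d_op (\<lambda>p. ?s p * anti_monomial (\<eta> p) S)
     (\<lambda>A'. (of_nat a * (X A' 0 * \<sigma> q 0 ^ (a - 1)) * \<sigma> q 1 ^ b +
      \<sigma> q 0 ^ a * (of_nat b * (X A' 1 * \<sigma> q 1 ^ (b - 1)))) * ?m +
       ?s q * (of_nat (card S) * (beta h q A' * ?m))) q"
    by (intro has_d_op_mult_even \<sigma> \<eta> central_powers[symmetric])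
  moreover have "(of_nat a * (X A' 0 * \<sigma> q 0 ^ (a - 1)) * \<sigma> q 1 ^ b +
      \<sigma> q 0 ^ a * (of_nat b * (X A' 1 * \<sigma> q 1 ^ (b - 1)))) * ?m +
       ?s q * (of_nat (card S) * (beta h q A' * ?m)) =
     of_nat (card S) * (beta h q A' * (?s q * ?m)) +
     (X A' 0 * (of_nat a * (\<sigma> q 0 ^ (a - 1) * \<sigma> q 1 ^ b * ?m)) +
      X A' 1 * (of_nat b * (\<sigma> q 0 ^ a * \<sigma> q 1 ^ (b - 1) * ?m)))" for A'
  proof -
    have 1: "?s q * (of_nat m * (x * y)) = of_nat m * (x * (?s q * y))" for x y m
      using central_powers[of q a b x] by (simp only: of_nat_left_commute) (simp only: mult.assoc[symmetric])
    have 2: "\<sigma> q 0 ^ a * (of_nat m * (x * y)) = of_nat m * (x * (\<sigma> q 0 ^ a * y))" for x y m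
      using central_power[of q 0 a x] by (simp only: of_nat_left_commute) (simp only: mult.assoc[symmetric])
    show ?thesis by (simp only: 1 2 distrib_right) (simp add: mult.assoc of_nat_left_commute add_ac)
  qed
  ultimately show ?thesis
    by (simp add: e substitute_monomial sum_two sderiv_monomial substitute_of_nat_mult)
qed

end

text \<open>
  The condition that defines the spaces \<open>\<V>\<^sub>j\<close>, for arbitrary degrees. Intermediate functions
  such as \<open>d\<^sup>A\<^sup>' f\<close> take values in spaces that are not among the \<open>\<V>\<^sub>j\<close>.
\<close>

definition bihomogeneous :: "nat \<Rightarrow> nat \<Rightarrow> 'n::{finite,linorder} sgpoly \<Rightarrow> bool" where
  "bihomogeneous r m v \<longleftrightarrow> (\<forall>a b S. coef v (a, b) S \<noteq> 0 \<longrightarrow> a + b = r \<and> card S = m)"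

definition exponents :: "nat \<Rightarrow> (nat \<times> nat) set" where
  "exponents r = {(a, b). a + b = r}"

lemma finite_exponents: "finite (exponents r)"
  by (rule finite_subset[of _ "{..r} \<times> {..r}"]) (auto simp: exponents_def)

lemma bihomogeneous_keys: "bihomogeneous r m v \<Longrightarrow> Poly_Mapping.keys v \<subseteq> exponents r"
proof
  fix e assume v: "bihomogeneous r m v" and e: "e \<in> Poly_Mapping.keys v"
  obtain a b where ab: "e = (a, b)" by force
  have "Poly_Mapping.lookup v e \<noteq> 0" using e by (simp add: in_keys_iff)
  then obtain S where "coef v e S \<noteq> 0"
    unfolding coef_def by (metis grassmann_eqI gcoeff_simps(1))
  then show "e \<in> exponents r"
    using v ab by (auto simp: bihomogeneous_def exponents_def)
qed

lemmas bihomogeneous_expand = sgpoly_expand[OF finite_exponents bihomogeneous_keys]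

lemma sderiv_degree_0:
  assumes "bihomogeneous 0 m v"
  shows "sderiv A' v = 0"
proof -
  have "sderiv A' (monomial e S) = 0" if "e \<in> exponents 0" for e and S :: "'a cindex set"
  proof -
    have "e = (0, 0)" using that by (auto simp: exponents_def)
    then show ?thesis using two_cases[of A'] by (auto simp: sderiv_monomial)
  qed
  then show ?thesis
    by (subst bihomogeneous_expand[OF assms]) (simp add: sderiv_sum sderiv_cst_mult)
qed

text \<open>
  Needed at \<open>j = k\<close>, where the source of the operator uses the lower and the target the upper
  variables.
\<close>

lemma substitute_degree_0:
  assumes "bihomogeneous 0 m v"
  shows "substitute \<sigma> \<eta> v = substitute \<sigma>' \<eta> v"
  unfolding substitute_def using bihomogeneous_keys[OF assms]
  by (intro sum.cong refl) (auto simp: exponents_def)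

lemma bihomogeneous_diff:
  "bihomogeneous r m v \<Longrightarrow> bihomogeneous r m w \<Longrightarrow> bihomogeneous r m (v - w)"
  unfolding bihomogeneous_def coef_simps by (metis diff_0_right)

lemma bihomogeneous_cst_mult: "bihomogeneous r m v \<Longrightarrow> bihomogeneous r m (cst c * v)"
  unfolding bihomogeneous_def coef_cst_mult by auto

lemma has_poly_gradient_coefficientwise:
  assumes "\<And>p. bihomogeneous r m (f p)" "\<And>e S. (\<lambda>p. coef (f p) e S) differentiable (at x)"
  shows "has_poly_gradient x f (\<lambda>A' A. \<Sum>e\<in>exponents r. \<Sum>S\<in>UNIV. cst (nabla A' A (\<lambda>p. coef (f p) e S) x) * monomial e S)"
proof -
  have "f = (\<lambda>p. \<Sum>e\<in>exponents r. \<Sum>S\<in>UNIV. cst (coef (f p) e S) * monomial e S)"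
    by (rule ext, rule bihomogeneous_expand[OF assms(1)])
  moreover have "has_poly_gradient x (\<lambda>p. \<Sum>e\<in>exponents r. \<Sum>S\<in>UNIV. cst (coef (f p) e S) * monomial e S)
     (\<lambda>A' A. \<Sum>e\<in>exponents r. \<Sum>S\<in>UNIV. cst (nabla A' A (\<lambda>p. coef (f p) e S) x) * monomial e S)"
    by (intro has_poly_gradient_sum has_poly_gradient.scalar_mult has_complex_gradient_nabla assms(2))
  ultimately show ?thesis by simp
qed

lemma coef_d_op:
  assumes "\<And>p. bihomogeneous r m (f p)" "\<And>e S. (\<lambda>p. coef (f p) e S) differentiable (at x)"
  shows "coef (d_op A' f x) e S =
    (\<Sum>A\<in>S. gsign {A} (S - {A}) * nabla A' A (\<lambda>p. coef (f p) e (S - {A})) x)"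
proof -
  note s = has_poly_gradient_coefficientwise[OF assms]
  have n: "coef (nabla_coef A' A f x) e T = nabla A' A (\<lambda>p. coef (f p) e T) x" for A T
    unfolding nabla_coef_eq[OF s] by (rule nabla_eq[OF has_poly_gradient_coef[OF s], symmetric])
  have "coef (d_op A' f x) e S = (\<Sum>A\<in>UNIV. if A \<in> S then
      gsign {A} (S - {A}) * nabla A' A (\<lambda>p. coef (f p) e (S - {A})) x else 0)"
    unfolding d_op_def coef_sum coef_omega_mult n ..
  then show ?thesis by (simp add: sum.If_cases)
qed

lemma bihomogeneous_d_op:
  assumes "\<And>p. bihomogeneous r m (f p)" "\<And>e S. (\<lambda>p. coef (f p) e S) differentiable (at x)"
  shows "bihomogeneous r (Suc m) (d_op A' f x)"
  unfolding bihomogeneous_def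
proof (intro allI impI)
  fix a b S assume "coef (d_op A' f x) (a, b) S \<noteq> 0"
  then obtain A where A: "A \<in> S" "nabla A' A (\<lambda>p. coef (f p) (a, b) (S - {A})) x \<noteq> 0"
    unfolding coef_d_op[OF assms] by (metis (no_types, lifting) mult_zero_right sum.neutral)
  have "\<exists>p. coef (f p) (a, b) (S - {A}) \<noteq> 0"
  proof (rule ccontr)
    assume "\<not> ?thesis"
    then have "(\<lambda>p. coef (f p) (a, b) (S - {A})) = (\<lambda>p. 0)" by auto
    with A(2) show False by (simp add: nabla_eq[OF has_complex_gradient_const])
  qed
  then obtain p where "coef (f p) (a, b) (S - {A}) \<noteq> 0" ..
  then have "a + b = r" "card (S - {A}) = m"
    using assms(1)[of p] by (auto simp: bihomogeneous_def)
  moreover have "card S = Suc (card (S - {A}))"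
    using card_Suc_Diff1[OF finite A(1)] ..
  ultimately show "a + b = r \<and> card S = Suc m" by simp
qed

lemma smooth_differentiable: "smooth_fun_on UNIV \<phi> \<Longrightarrow> \<phi> differentiable (at x)"
  unfolding smooth_fun_on_def by (metis Ck_on.simps(2) UNIV_I)

lemma nabla_differentiable:
  assumes "smooth_fun_on UNIV \<phi>"
  shows "(\<lambda>p. nabla A' A \<phi> p) differentiable (at x)"
proof -
  have "(\<lambda>p. pderiv_dir l u \<phi> p) differentiable (at x)" for l u
  proof -
    have "pderiv_dir l u \<phi> = (\<lambda>p. frechet_derivative \<phi> (at p) (axis l u))"
      by (intro ext pderiv_dir_eq) (simp add: smooth_differentiable[OF assms] flip: frechet_derivative_works)
    moreover have "Ck_on (Suc (Suc 0)) UNIV \<phi>" using assms by (simp only: smooth_fun_on_def)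
    ultimately show ?thesis by simp
  qed
  then show ?thesis
    unfolding nabla_def Let_def
    by (cases "A' = 0"; cases "pos A = 0") (simp_all add: differentiable_mult)
qed

lemma coef_d_op_differentiable:
  assumes "\<And>p. bihomogeneous r m (f p)" "\<And>e S. smooth_fun_on UNIV (\<lambda>p. coef (f p) e S)"
  shows "(\<lambda>p. coef (d_op A' f p) e S) differentiable (at x)"
  unfolding coef_d_op[OF assms(1) smooth_differentiable[OF assms(2)]]
  by (intro differentiable_sum ballI differentiable_mult nabla_differentiable assms(2)) simp_all

context substitution_family
begin

text \<open>
  Expand \<open>f\<close> in monomials and apply the Leibniz rule to each coefficient times its substituted
  monomial. The derivatives of the coefficients reassemble to the \<open>d_op\<close> of \<open>f\<close> at the image point
  by the chain rule and \<open>\<Psi>(\<omega>\<^sup>B v) = \<eta>\<^sup>B \<Psi>(v)\<close>; the degree in \<open>\<omega>\<close> being constant, the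
  terms with \<open>\<beta>\<close> have the common factor \<open>m\<close>.
\<close>

lemma has_d_op_pullback:
  assumes f: "\<And>p. bihomogeneous r m (f p)"
    and diff: "\<And>e S. (\<lambda>p. coef (f p) e S) differentiable (at (frac_act h q))"
  shows "has_d_op (\<lambda>p. \<Psi> p (f (frac_act h p)))
    (\<lambda>A'. of_nat m * (beta h q A' * \<Psi> q (f (frac_act h q))) +
      (\<Sum>C'\<in>UNIV. X A' C' * \<Psi> q (sderiv C' (f (frac_act h q)))) +
      (\<Sum>B'\<in>UNIV. cst (inv_tau h q A' B') * \<Psi> q (d_op B' f (frac_act h q)))) q"
proof -
  let ?x = "frac_act h q" and ?E = "exponents r"
  let ?n = "\<lambda>A' A e S. nabla A' A (\<lambda>p. coef (f p) e S) ?x"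
  let ?G = "\<lambda>e S A'. one_form (\<lambda>A. \<Sum>B\<in>UNIV. \<Sum>B'\<in>UNIV. ?n B' B e S * (tau (J2 h q) $ B $ A * inv_tau h q A' B'))"
  have expand: "f p = (\<Sum>e\<in>?E. \<Sum>S\<in>UNIV. cst (coef (f p) e S) * monomial e S)" for p
    by (rule bihomogeneous_expand[OF f])
  have \<Psi>f: "\<Psi> p (f y) = (\<Sum>e\<in>?E. \<Sum>S\<in>UNIV. cst (coef (f y) e S) * \<Psi> p (monomial e S))" for p y
    by (subst expand) (simp only: substitute_sum substitute_cst_mult)
  have "has_d_op (\<lambda>p. \<Sum>e\<in>?E. \<Sum>S\<in>UNIV. cst (coef (f (frac_act h p)) e S) * \<Psi> p (monomial e S))
    (\<lambda>A'. \<Sum>e\<in>?E. \<Sum>S\<in>UNIV. ?G e S A' * \<Psi> q (monomial e S) +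
      cst (coef (f ?x) e S) * (of_nat (card S) * (beta h q A' * \<Psi> q (monomial e S)) +
        (\<Sum>C'\<in>UNIV. X A' C' * \<Psi> q (sderiv C' (monomial e S))))) q"
    by (intro has_d_op_sum has_d_op_cst_mult has_d_op_substitute_monomial has_complex_gradient_compose_frac_act[OF J1]
        has_complex_gradient_nabla diff)
  moreover have "(\<Sum>e\<in>?E. \<Sum>S\<in>UNIV. ?G e S A' * \<Psi> q (monomial e S) +
      cst (coef (f ?x) e S) * (of_nat (card S) * (beta h q A' * \<Psi> q (monomial e S)) +
        (\<Sum>C'\<in>UNIV. X A' C' * \<Psi> q (sderiv C' (monomial e S))))) =
    of_nat m * (beta h q A' * \<Psi> q (f ?x)) +
      (\<Sum>C'\<in>UNIV. X A' C' * \<Psi> q (sderiv C' (f ?x))) +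
      (\<Sum>B'\<in>UNIV. cst (inv_tau h q A' B') * \<Psi> q (d_op B' f ?x))" for A'
  proof -
    have 1: "(\<Sum>e\<in>?E. \<Sum>S\<in>UNIV. ?G e S A' * \<Psi> q (monomial e S)) =
      (\<Sum>B'\<in>UNIV. cst (inv_tau h q A' B') * \<Psi> q (d_op B' f ?x))"
    proof -
      have G: "?G e S A' = (\<Sum>B'\<in>UNIV. cst (inv_tau h q A' B') * (\<Sum>B\<in>UNIV. cst (?n B' B e S) * \<eta> q B))" for e S
      proof -
        have "?G e S A' = (\<Sum>A\<in>UNIV. \<Sum>B\<in>UNIV. \<Sum>B'\<in>UNIV.
            cst (inv_tau h q A' B') * (cst (?n B' B e S) * (cst (tau (J2 h q) $ B $ A) * omega A)))"
          unfolding one_form_def cst_sum sum_distrib_right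
          by (intro sum.cong refl) (simp only: cst_simps(6)[symmetric] mult.assoc[symmetric], simp only: mult_ac)
        also have "\<dots> = (\<Sum>B\<in>UNIV. \<Sum>B'\<in>UNIV. \<Sum>A\<in>UNIV.
            cst (inv_tau h q A' B') * (cst (?n B' B e S) * (cst (tau (J2 h q) $ B $ A) * omega A)))"
          by (subst sum.swap, subst (2) sum.swap, rule refl)
        also have "\<dots> = (\<Sum>B'\<in>UNIV. \<Sum>B\<in>UNIV. cst (inv_tau h q A' B') * (cst (?n B' B e S) * \<eta> q B))"
          by (subst sum.swap) (simp only: act_omega_def sum_distrib_left)
        finally show ?thesis by (simp only: sum_distrib_left)
      qed
      have d: "\<Psi> q (d_op B' f ?x) = (\<Sum>e\<in>?E. \<Sum>S\<in>UNIV. (\<Sum>B\<in>UNIV. cst (?n B' B e S) * \<eta> q B) * \<Psi> q (monomial e S))" for B'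
      proof -
        have "\<Psi> q (d_op B' f ?x) = (\<Sum>B\<in>UNIV. \<Sum>e\<in>?E. \<Sum>S\<in>UNIV. cst (?n B' B e S) * \<eta> q B * \<Psi> q (monomial e S))"
          unfolding d_op_def nabla_coef_eq[OF has_poly_gradient_coefficientwise[OF f diff]]
          by (simp only: substitute_sum substitute_omega_mult substitute_cst_mult sum_distrib_left
              cst_left_commute mult.assoc)
        also have "\<dots> = (\<Sum>e\<in>?E. \<Sum>S\<in>UNIV. \<Sum>B\<in>UNIV. cst (?n B' B e S) * \<eta> q B * \<Psi> q (monomial e S))"
          by (subst sum.swap, subst (2) sum.swap, rule refl)
        finally show ?thesis by (simp only: sum_distrib_right)
      qed
      have "(\<Sum>e\<in>?E. \<Sum>S\<in>UNIV. (\<Sum>B'\<in>UNIV. a B' * K B' e S) * M e S) =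
          (\<Sum>B'\<in>UNIV. a B' * (\<Sum>e\<in>?E. \<Sum>S\<in>UNIV. K B' e S * M e S))"
        for a :: "2 \<Rightarrow> 'n sgpoly" and K and M :: "nat \<times> nat \<Rightarrow> 'n cindex set \<Rightarrow> 'n sgpoly"
        by (simp only: sum_two distrib_right sum.distrib sum_distrib_left mult.assoc)
      then show ?thesis
        unfolding G d .
    qed
    have "coef (f ?x) e S = 0 \<or> card S = m" for e S
      using f[of ?x] by (cases e) (auto simp: bihomogeneous_def)
    then have "cst (coef (f ?x) e S) * (of_nat (card S) * w) = of_nat m * (cst (coef (f ?x) e S) * w)" for e S and w :: "'n sgpoly"
      by (metis of_nat_left_commute cst_simps(1) mult_zero_left mult_zero_right)
    then have 2: "(\<Sum>e\<in>?E. \<Sum>S\<in>UNIV. cst (coef (f ?x) e S) * (of_nat (card S) * (beta h q A' * \<Psi> q (monomial e S)))) =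
      of_nat m * (beta h q A' * \<Psi> q (f ?x))"
      unfolding \<Psi>f by (simp only: sum_distrib_left cst_left_commute)
    have 3: "(\<Sum>e\<in>?E. \<Sum>S\<in>UNIV. cst (coef (f ?x) e S) * (\<Sum>C'\<in>UNIV. X A' C' * \<Psi> q (sderiv C' (monomial e S)))) =
      (\<Sum>C'\<in>UNIV. X A' C' * \<Psi> q (sderiv C' (f ?x)))"
      by (subst (2) expand) (simp only: sderiv_sum sderiv_cst_mult substitute_sum substitute_cst_mult
        sum_two sum_distrib_left cst_left_commute distrib_left sum.distrib)
    show ?thesis
      unfolding 1[symmetric] 2[symmetric] 3[symmetric]
      by (simp only: distrib_left sum.distrib add_ac)
  qed
  ultimately show ?thesis unfolding \<Psi>f by simp
qed

end


section \<open>Invariance of the operators\<close>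

definition weight :: "quat^('n::finite option)^('n option) \<Rightarrow> nat \<Rightarrow> 'n hspace \<Rightarrow> complex" where
  "weight h l q = complex_of_real (1 / norm (J1 h q) ^ (2 * l))"

text \<open>
  Passing from one weight to the next multiplies by \<open>det P\<close>, the factor produced by
  antisymmetrizing a product of two matrices \<open>P\<close>.
\<close>

lemma weight_Suc:
  "weight h (Suc l) q = weight h l q *
    (inv_tau h q 0 0 * inv_tau h q 1 1 - inv_tau h q 0 1 * inv_tau h q 1 0)"
  unfolding det_inv_tau weight_def by (simp add: power2_eq_square)

context substitution_family
begin

text \<open>
  The weight contributes \<open>- l \<beta>\<close> and the Grassmann factors \<open>m \<beta>\<close>, so \<open>\<beta>\<close> survives only if the degree
  differs from the weight.
\<close>

lemma has_d_op_weighted_pullback: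
  assumes f: "\<And>p. bihomogeneous r m (f p)"
    and diff: "\<And>e S. (\<lambda>p. coef (f p) e S) differentiable (at (frac_act h q))"
  shows "has_d_op (\<lambda>p. cst (weight h l p) * \<Psi> p (f (frac_act h p)))
    (\<lambda>A'. cst (weight h l q) * ((of_nat m - of_nat l) * (beta h q A' * \<Psi> q (f (frac_act h q))) +
      (\<Sum>C'\<in>UNIV. X A' C' * \<Psi> q (sderiv C' (f (frac_act h q)))) +
      (\<Sum>B'\<in>UNIV. cst (inv_tau h q A' B') * \<Psi> q (d_op B' f (frac_act h q))))) q"
proof -
  have "has_d_op (\<lambda>p. cst (weight h l p) * \<Psi> p (f (frac_act h p)))
    (\<lambda>A'. - (of_nat l * (cst (weight h l q) * beta h q A')) * \<Psi> q (f (frac_act h q)) +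
      cst (weight h l q) * (of_nat m * (beta h q A' * \<Psi> q (f (frac_act h q))) +
      (\<Sum>C'\<in>UNIV. X A' C' * \<Psi> q (sderiv C' (f (frac_act h q)))) +
      (\<Sum>B'\<in>UNIV. cst (inv_tau h q A' B') * \<Psi> q (d_op B' f (frac_act h q))))) q"
    unfolding weight_def
    by (intro has_d_op_mult_even has_d_op_norm_power J1 has_d_op_pullback[OF f diff] cst_commute[symmetric])
  moreover have "- (of_nat l * (cst c * b)) * u + cst c * (of_nat m * (b * u) + x + y) =
      cst c * ((of_nat m - of_nat l) * (b * u) + x + y)" for c and b u x y :: "'n sgpoly"
    by (simp add: distrib_left left_diff_distrib right_diff_distrib mult.assoc of_nat_left_commute)
  ultimately show ?thesis by simp
qed

end

lemma act_s_lower_central: "act_s_lower x A' * v = v * act_s_lower x A'"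
  unfolding act_s_lower_def sum_distrib_left sum_distrib_right
  by (intro sum.cong refl) (simp only: mult.assoc cst_left_commute svar_commute)

lemma act_s_upper_central: "act_s_upper x A' * v = v * act_s_upper x A'"
  unfolding act_s_upper_def sum_distrib_left sum_distrib_right
  by (intro sum.cong refl) (simp only: mult.assoc cst_left_commute svar_commute)

lemma lower_family:
  assumes "J1 h q \<noteq> 0"
  shows "substitution_family h (\<lambda>p. act_s_lower (inverse (J1 h p)))
    (\<lambda>A' C'. - (cst (inv_tau h q A' C') * theta h q)) q"
  by standard (intro assms act_s_lower_central has_d_op_act_s_lower)+

lemma upper_family:
  assumes "J1 h q \<noteq> 0"
  shows "substitution_family h (\<lambda>p. act_s_upper (J1 h p)) (\<lambda>A' C'. svar A' * tau_b_form h C') q"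
  by standard (intro assms act_s_upper_central has_d_op_act_s_upper)+

lemma sderiv_act_s_lower:
  "sderiv A' (act_s_lower (inverse (J1 h q)) C') = cst (inv_tau h q A' C')"
  using two_cases[of A']
  by (auto simp: act_s_lower_def inv_tau_def sum_two sderiv_add sderiv_cst_mult sderiv_simps)

lemma sderiv_theta: "sderiv A' (theta h q) = beta h q A'"
  using two_cases[of A']
  by (auto simp: theta_def sum_two sderiv_add sderiv_mult beta_def sderiv_one_form sderiv_simps)

lemma sderiv_beta: "sderiv A' (beta h q B') = 0"
  by (simp add: beta_def sderiv_one_form)

text \<open>
  With \<open>D = det P\<close>, the matrix \<open>D \<tau>(J1)\<close> is the adjugate of \<open>P\<close>.
\<close>

lemma adjugate:
  assumes "J1 h q \<noteq> 0"
  defines "P \<equiv> inv_tau h q"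
  defines "D \<equiv> P 0 0 * P 1 1 - P 0 1 * P 1 0"
  shows "D * qtau (J1 h q) $ 0 $ 0 = P 1 1" "D * qtau (J1 h q) $ 0 $ 1 = - P 0 1"
    "D * qtau (J1 h q) $ 1 $ 0 = - P 1 0" "D * qtau (J1 h q) $ 1 $ 1 = P 0 0"
proof -
  have "qtau (inverse (J1 h q) * J1 h q) $ i $ j = (if i = j then 1 else 0)" for i j
    using assms(1) by (simp add: qtau_1)
  then have *: "P i 0 * qtau (J1 h q) $ 0 $ j + P i 1 * qtau (J1 h q) $ 1 $ j = (if i = j then 1 else 0)" for i j
    by (simp add: qtau_mult sum_two P_def inv_tau_def)
  note e = *[of 0 0, simplified] *[of 0 1, simplified] *[of 1 0, simplified] *[of 1 1, simplified]
  show "D * qtau (J1 h q) $ 0 $ 0 = P 1 1" "D * qtau (J1 h q) $ 0 $ 1 = - P 0 1"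
    "D * qtau (J1 h q) $ 1 $ 0 = - P 1 0" "D * qtau (J1 h q) $ 1 $ 1 = P 0 0"
    unfolding D_def using e by algebra+
qed

text \<open>
  The degree in \<open>\<omega>\<close> is one less than the weight \<open>j + 1\<close>, so that
  \<open>d\<^sup>A\<^sup>' R = |J1|\<^sup>-\<^sup>2\<^sup>(\<^sup>j\<^sup>+\<^sup>1\<^sup>) (- \<beta>\<^sup>A\<^sup>' u - \<theta> \<partial>\<^sup>A\<^sup>' u + \<Sum> P\<^sup>A\<^sup>'\<^sub>B\<^sub>' Z\<^sub>B\<^sub>')\<close>. Applying \<open>\<partial>\<^sup>B\<^sup>'\<close> to
  the first two terms gives \<open>- \<beta>\<^sup>A\<^sup>' \<partial>\<^sup>B\<^sup>' u - \<beta>\<^sup>B\<^sup>' \<partial>\<^sup>A\<^sup>' u - \<theta> \<partial>\<^sup>B\<^sup>' \<partial>\<^sup>A\<^sup>' u\<close>, which is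
  symmetric in the two indices and disappears in the antisymmetrization.
\<close>

lemma invariance_lower:
  assumes q: "J1 h q \<noteq> 0"
    and f: "\<And>p. bihomogeneous r j (f p)"
    and diff: "\<And>e S. (\<lambda>p. coef (f p) e S) differentiable (at (frac_act h q))"
  defines "\<Psi> \<equiv> \<lambda>p. substitute (act_s_lower (inverse (J1 h p))) (act_omega (J2 h p))"
  defines "R \<equiv> \<lambda>p. cst (weight h (Suc j) p) * \<Psi> p (f (frac_act h p))"
  shows "cst (1/2) * (sderiv 0 (d_op 1 R q) - sderiv 1 (d_op 0 R q)) =
    cst (weight h (Suc (Suc j)) q) * \<Psi> q (cst (1/2) *
      (sderiv 0 (d_op 1 f (frac_act h q)) - sderiv 1 (d_op 0 f (frac_act h q))))"
proof -
  interpret F: substitution_family h "\<lambda>p. act_s_lower (inverse (J1 h p))"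
    "\<lambda>A' C'. - (cst (inv_tau h q A' C') * theta h q)" q
    by (rule lower_family[OF q])
  have \<Psi>: "substitute (act_s_lower (inverse (J1 h p))) (act_omega (J2 h p)) = \<Psi> p" for p
    by (simp only: \<Psi>_def)
  let ?x = "frac_act h q" and ?P = "inv_tau h q" and ?n = "weight h (Suc j) q"
  define u where "u = \<Psi> q (f ?x)"
  define Z where "Z B' = \<Psi> q (d_op B' f ?x)" for B'
  define Y where "Y D' B' = \<Psi> q (sderiv D' (d_op B' f ?x))" for D' B'
  have s: "sderiv A' (\<Psi> q v) = (\<Sum>C'\<in>UNIV. cst (?P A' C') * \<Psi> q (sderiv C' v))" for A' v
    unfolding \<Psi>_def
    by (rule F.sderiv_substitute) (simp_all only: sderiv_act_s_lower act_omega_one_form sderiv_one_form)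
  have sZ: "sderiv A' (Z B') = (\<Sum>C'\<in>UNIV. cst (?P A' C') * Y C' B')" for A' B'
    by (simp only: Z_def Y_def s)
  have X: "(\<Sum>C'\<in>UNIV. - (cst (?P A' C') * theta h q) * \<Psi> q (sderiv C' (f ?x))) = - (theta h q * sderiv A' u)" for A'
    unfolding u_def s by (simp add: sum_distrib_left sum_negf mult.assoc cst_left_commute[of "theta h q"])
  have d: "d_op A' R q = cst ?n * (- (beta h q A' * u) - theta h q * sderiv A' u +
      (\<Sum>B'\<in>UNIV. cst (?P A' B') * Z B'))" for A'
    using d_op_eq[OF F.has_d_op_weighted_pullback[OF f diff, where l = "Suc j"], of A', unfolded \<Psi>, unfolded X]
    by (simp add: R_def u_def Z_def)
  have sd: "sderiv B' (d_op A' R q) = cst ?n * (- (beta h q A' * sderiv B' u) -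
      (beta h q B' * sderiv A' u + theta h q * sderiv B' (sderiv A' u)) +
      (\<Sum>C'\<in>UNIV. cst (?P A' C') * sderiv B' (Z C')))" for A' B'
    unfolding d
    by (simp add: sderiv_cst_mult sderiv_add sderiv_diff sderiv_uminus sderiv_mult[of _ "beta h q _"] sderiv_mult[of _ "theta h q"]
        sderiv_beta sderiv_theta sderiv_sum)
  have "sderiv 0 (d_op 1 R q) - sderiv 1 (d_op 0 R q) = cst ?n *
      ((\<Sum>C'\<in>UNIV. cst (?P 1 C') * sderiv 0 (Z C')) - (\<Sum>C'\<in>UNIV. cst (?P 0 C') * sderiv 1 (Z C')))"
    unfolding sd sderiv_commute[of 1 0 u] right_diff_distrib[symmetric] by simp
  also have "cst (1/2) * \<dots> = cst (weight h (Suc (Suc j)) q) * (cst (1/2) * (Y 0 1 - Y 1 0))"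
    unfolding sZ sum_two weight_Suc[of h "Suc j"]
    by (intro sgpoly_eqI) (simp add: coef_cst_mult field_simps)
  finally show ?thesis
    unfolding \<Psi>_def Y_def by (simp only: F.substitute_cst_mult F.substitute_diff)
qed

text \<open>
  The weight equals the degree in \<open>\<omega>\<close>, so \<open>\<beta>\<close> does not occur, and the derivatives of the
  \<open>s\<close>-variables contribute \<open>s\<^sup>A\<^sup>' Y\<close> with \<open>Y\<close> independent of \<open>A'\<close>. In the remaining term the original
  variables \<open>s\<close> have to be rewritten by the transformed ones, which is what the adjugate of \<open>P\<close>
  does.
\<close>

lemma invariance_upper:
  assumes q: "J1 h q \<noteq> 0"
    and f: "\<And>p. bihomogeneous r m (f p)"
    and diff: "\<And>e S. (\<lambda>p. coef (f p) e S) differentiable (at (frac_act h q))"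
  defines "\<Psi> \<equiv> \<lambda>p. substitute (act_s_upper (J1 h p)) (act_omega (J2 h p))"
  defines "R \<equiv> \<lambda>p. cst (weight h m p) * \<Psi> p (f (frac_act h p))"
  shows "cst (1/2) * (svar 0 * d_op 1 R q - svar 1 * d_op 0 R q) =
    cst (weight h (Suc m) q) * \<Psi> q (cst (1/2) *
      (svar 0 * d_op 1 f (frac_act h q) - svar 1 * d_op 0 f (frac_act h q)))"
proof -
  interpret F: substitution_family h "\<lambda>p. act_s_upper (J1 h p)" "\<lambda>A' C'. svar A' * tau_b_form h C'" q
    by (rule upper_family[OF q])
  have \<Psi>: "substitute (act_s_upper (J1 h p)) (act_omega (J2 h p)) = \<Psi> p" for p
    by (simp only: \<Psi>_def)
  let ?x = "frac_act h q" and ?P = "inv_tau h q" and ?n = "weight h m q"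
  define Y where "Y = (\<Sum>C'\<in>UNIV. tau_b_form h C' * \<Psi> q (sderiv C' (f ?x)))"
  define Z where "Z B' = \<Psi> q (d_op B' f ?x)" for B'
  have X: "(\<Sum>C'\<in>UNIV. svar A' * tau_b_form h C' * \<Psi> q (sderiv C' (f ?x))) = svar A' * Y" for A'
    by (simp add: Y_def sum_distrib_left mult.assoc)
  have d: "d_op A' R q = cst ?n * (svar A' * Y + (\<Sum>B'\<in>UNIV. cst (?P A' B') * Z B'))" for A'
    using d_op_eq[OF F.has_d_op_weighted_pullback[OF f diff, where l = m], of A', unfolded \<Psi>, unfolded X]
    by (simp add: R_def Z_def)
  have "svar 0 * (svar 1 * Y) = svar 1 * (svar 0 * Y)"
    by (simp only: mult.assoc[symmetric] svar_commute[of 0 "svar 1"])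
  then have "svar 0 * d_op 1 R q - svar 1 * d_op 0 R q = cst ?n *
      ((\<Sum>B'\<in>UNIV. cst (?P 1 B') * (svar 0 * Z B')) - (\<Sum>B'\<in>UNIV. cst (?P 0 B') * (svar 1 * Z B')))"
    unfolding d
    by (simp add: cst_left_commute[of "svar _"] distrib_left sum_distrib_left right_diff_distrib)
  also have "cst (1/2) * \<dots> = cst (weight h (Suc m) q) *
      (cst (1/2) * (act_s_upper (J1 h q) 0 * Z 1 - act_s_upper (J1 h q) 1 * Z 0))"
  proof -
    define D where "D = ?P 0 0 * ?P 1 1 - ?P 0 1 * ?P 1 0"
    have w: "weight h (Suc m) q = ?n * D"
      by (simp only: weight_Suc D_def)
    have P: "?P 1 1 = D * qtau (J1 h q) $ 0 $ 0" "?P 0 1 = - (D * qtau (J1 h q) $ 0 $ 1)"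
      "?P 1 0 = - (D * qtau (J1 h q) $ 1 $ 0)" "?P 0 0 = D * qtau (J1 h q) $ 1 $ 1"
      unfolding D_def adjugate[OF q] by simp_all
    have "cst (weight h (Suc m) q) * (act_s_upper (J1 h q) 0 * Z 1 - act_s_upper (J1 h q) 1 * Z 0) =
      cst ?n * (cst (?P 1 1) * (svar 0 * Z 1) - cst (?P 0 1) * (svar 1 * Z 1) +
        cst (?P 1 0) * (svar 0 * Z 0) - cst (?P 0 0) * (svar 1 * Z 0))"
      unfolding w P
      by (intro sgpoly_eqI) (simp add: coef_cst_mult act_s_upper_def sum_two distrib_right mult.assoc algebra_simps)
    then have "cst (1/2) * (cst (weight h (Suc m) q) * (act_s_upper (J1 h q) 0 * Z 1 - act_s_upper (J1 h q) 1 * Z 0)) =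
      cst (1/2) * (cst ?n * (cst (?P 1 1) * (svar 0 * Z 1) - cst (?P 0 1) * (svar 1 * Z 1) +
        cst (?P 1 0) * (svar 0 * Z 0) - cst (?P 0 0) * (svar 1 * Z 0)))"
      by (simp only:)
    then show ?thesis
      by (simp add: cst_left_commute[of "cst (weight _ _ _)"] sum_two add_diff_eq diff_add_eq add.commute diff_diff_eq)
  qed
  finally show ?thesis
    unfolding Z_def \<Psi>_def
    by (simp only: F.substitute_cst_mult F.substitute_diff F.substitute_svar_mult)
qed

lemma eventually_J1_nonzero: "J1 h q \<noteq> 0 \<Longrightarrow> \<forall>\<^sub>F p in nhds q. J1 h p \<noteq> 0"
proof -
  assume "J1 h q \<noteq> 0"
  moreover have "isCont (J1 h) q" using has_derivative_J1 by (rule has_derivative_continuous)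
  ultimately show ?thesis
    unfolding isCont_def by (metis tendsto_at_iff_tendsto_nhds tendsto_imp_eventually_ne)
qed

text \<open>
  The first derivative of \<open>R\<close> is computed on a whole neighbourhood of \<open>q\<close> in order to be
  differentiated again. Write it as \<open>- \<beta>\<^sup>A\<^sup>' U + \<Sum> P\<^sup>A\<^sup>'\<^sub>B\<^sub>' Z\<^sub>B\<^sub>'\<close>. In its derivative
  \<open>d\<^sup>C\<^sup>'\<close>, the term \<open>- (d\<^sup>C\<^sup>' \<beta>\<^sup>A\<^sup>') U = - \<beta>\<^sup>C\<^sup>' \<beta>\<^sup>A\<^sup>' U\<close> cancels against the part of
  \<open>\<beta>\<^sup>A\<^sup>' d\<^sup>C\<^sup>' U\<close> containing \<open>U\<close>, and the part containing \<open>Z\<close> against \<open>\<Sum> (d\<^sup>C\<^sup>' P\<^sup>A\<^sup>'\<^sub>B\<^sub>') Z\<^sub>B\<^sub>'\<close>.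
  The functions \<open>Z\<close> have degree \<open>k + 1\<close> in \<open>\<omega>\<close>, equal to the weight, so that their derivatives
  contain no \<open>\<beta>\<close>.
\<close>

lemma invariance_middle:
  assumes q: "J1 h q \<noteq> 0"
    and f: "\<And>p. bihomogeneous 0 k (f p)"
    and smooth: "\<And>e S. smooth_fun_on UNIV (\<lambda>p. coef (f p) e S)"
  defines "\<Psi> \<equiv> \<lambda>p. substitute (act_s_lower (inverse (J1 h p))) (act_omega (J2 h p))"
  defines "R \<equiv> \<lambda>p. cst (weight h (Suc k) p) * \<Psi> p (f (frac_act h p))"
  shows "cst (1/2) * (d_op 0 (d_op 1 R) q - d_op 1 (d_op 0 R) q) =
    cst (weight h (Suc (Suc k)) q) * \<Psi> q (cst (1/2) *
      (d_op 0 (d_op 1 f) (frac_act h q) - d_op 1 (d_op 0 f) (frac_act h q)))"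
proof -
  have \<Psi>: "substitute (act_s_lower (inverse (J1 h p))) (act_omega (J2 h p)) = \<Psi> p" for p
    by (simp only: \<Psi>_def)
  let ?P = "inv_tau h" and ?n = "\<lambda>p. cst (weight h (Suc k) p)" and ?x = "\<lambda>p. frac_act h p"
  note diff = smooth_differentiable[OF smooth]
  have df: "bihomogeneous 0 (Suc k) (d_op B' f p)" for B' p
    by (rule bihomogeneous_d_op[OF f diff])
  note ddf = coef_d_op_differentiable[OF f smooth]
  define U where "U p = ?n p * \<Psi> p (f (?x p))" for p
  define Z where "Z B' p = ?n p * \<Psi> p (d_op B' f (?x p))" for B' p
  define Q where "Q D' B' = \<Psi> q (d_op D' (d_op B' f) (?x q))" for D' B'
  \<comment> \<open>The weight exceeds the degree of f by one, whence the term in beta; the one with the s-variables vanishes in degree 0.\<close>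
  have dU: "has_d_op U (\<lambda>A'. - (beta h p A' * U p) + (\<Sum>B'\<in>UNIV. cst (?P p A' B') * Z B' p)) p"
    if p: "J1 h p \<noteq> 0" for p
  proof -
    interpret F: substitution_family h "\<lambda>p. act_s_lower (inverse (J1 h p))"
      "\<lambda>A' C'. - (cst (inv_tau h p A' C') * theta h p)" p
      by (rule lower_family[OF p])
    show ?thesis
      using F.has_d_op_weighted_pullback[OF f diff, where l = "Suc k", unfolded \<Psi>]
      by (simp add: U_def[abs_def] Z_def sderiv_degree_0[OF f] F.substitute_0[unfolded \<Psi>]
          cst_left_commute[of _ "weight h (Suc k) p"] sum_distrib_left distrib_left right_diff_distrib)
  qed
  have dZ: "has_d_op (Z B') (\<lambda>A'. ?n q * (\<Sum>D'\<in>UNIV. cst (?P q A' D') * Q D' B')) q" for B'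
  proof -
    interpret F: substitution_family h "\<lambda>p. act_s_lower (inverse (J1 h p))"
      "\<lambda>A' C'. - (cst (inv_tau h q A' C') * theta h q)" q
      by (rule lower_family[OF q])
    show ?thesis
      using F.has_d_op_weighted_pullback[OF df ddf, where l = "Suc k", unfolded \<Psi>]
      by (simp add: Z_def[abs_def] Q_def sderiv_degree_0[OF df] F.substitute_0[unfolded \<Psi>])
  qed
  have dR: "d_op A' R p = - (beta h p A' * U p) + (\<Sum>B'\<in>UNIV. cst (?P p A' B') * Z B' p)"
    if "J1 h p \<noteq> 0" for A' p
    using d_op_eq[OF dU[OF that]] by (simp add: U_def[abs_def] R_def)
  have ddR: "d_op C' (d_op A' R) q = ?n q * (\<Sum>B'\<in>UNIV. cst (?P q A' B') * (\<Sum>D'\<in>UNIV. cst (?P q C' D') * Q D' B'))"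
    for A' C'
  proof -
    let ?b = "beta h q"
    let ?W = "\<lambda>C'. - (?b C' * U q) + (\<Sum>B'\<in>UNIV. cst (?P q C' B') * Z B' q)"
    let ?V = "\<lambda>C' B'. ?n q * (\<Sum>D'\<in>UNIV. cst (?P q C' D') * Q D' B')"
    have o: "omega A * ?b A' = - (?b A' * omega A)" for A
      unfolding beta_def by (rule omega_one_form_anticommute)
    \<comment> \<open>The minus sign is a scalar factor so that the Leibniz rules apply as they stand.\<close>
    have 1: "has_d_op (\<lambda>p. cst (- 1) * (beta h p A' * U p))
        (\<lambda>C'. 0 * (?b A' * U q) + cst (- 1) * (?b C' * ?b A' * U q - ?b A' * ?W C')) q"
      by (intro has_d_op_mult_even has_d_op_const has_d_op_mult_odd has_d_op_beta q dU o cst_commute[symmetric])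
    have 2: "has_d_op (\<lambda>p. \<Sum>B'\<in>UNIV. cst (?P p A' B') * Z B' p)
        (\<lambda>C'. \<Sum>B'\<in>UNIV. - (cst (?P q C' B') * ?b A') * Z B' q + cst (?P q A' B') * ?V C' B') q"
      by (intro has_d_op_sum has_d_op_mult_even has_d_op_inv_tau q dZ cst_commute[symmetric])
    have "\<forall>\<^sub>F p in nhds q. d_op A' R p = cst (- 1) * (beta h p A' * U p) + (\<Sum>B'\<in>UNIV. cst (?P p A' B') * Z B' p)"
      using eventually_J1_nonzero[OF q] by eventually_elim (simp add: dR cst_simps)
    from d_op_eq[OF has_d_op_cong[OF has_d_op_add[OF 1 2] this], of C']
    have "d_op C' (d_op A' R) q = cst (- 1) * (?b C' * ?b A' * U q - ?b A' * ?W C') +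
      (\<Sum>B'\<in>UNIV. - (cst (?P q C' B') * ?b A') * Z B' q + cst (?P q A' B') * ?V C' B')"
      by simp
    also have "\<dots> = (\<Sum>B'\<in>UNIV. cst (?P q A' B') * ?V C' B')"
    proof -
      have "?b C' * ?b A' = - (?b A' * ?b C')"
        unfolding beta_def by (rule one_form_anticommute)
      then show ?thesis
        by (simp add: cst_simps distrib_left sum.distrib sum_negf sum_distrib_left mult.assoc
            cst_left_commute[of "beta h q _"] right_diff_distrib sum_subtractf)
    qed
    finally show ?thesis by (simp only: sum_distrib_left cst_left_commute[of _ "weight h (Suc k) q"])
  qed
  interpret F: substitution_family h "\<lambda>p. act_s_lower (inverse (J1 h p))"
      "\<lambda>A' C'. - (cst (inv_tau h q A' C') * theta h q)" q
    by (rule lower_family[OF q])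
  have "cst (1/2) * (d_op 0 (d_op 1 R) q - d_op 1 (d_op 0 R) q) =
    cst (weight h (Suc (Suc k)) q) * (cst (1/2) * (Q 0 1 - Q 1 0))"
    unfolding ddR sum_two weight_Suc[of h "Suc k"]
    by (intro sgpoly_eqI) (simp add: coef_cst_mult field_simps)
  then show ?thesis
    unfolding Q_def \<Psi>_def by (simp only: F.substitute_cst_mult F.substitute_diff)
qed

theorem theorem1p1:
  fixes k j :: nat
    and g :: "quat^('n::{finite,linorder} option)^('n option)"
    and f :: "'n hspace \<Rightarrow> 'n sgpoly"
  assumes "j + 2 \<le> 2 * CARD('n)"
    and "g \<in> SL_quat"
    and "f \<in> Gamma_space k j UNIV"
  shows "\<forall>q \<in> {q :: 'n hspace. J1 (matrix_inv g) q \<noteq> 0}.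
           CF_op k j (rep k j g f) q = rep k (j + 1) g (CF_op k j f) q"
proof (intro ballI, unfold mem_Collect_eq)
  fix q :: "'n hspace"
  let ?h = "matrix_inv g"
  assume q: "J1 ?h q \<noteq> 0"
  have f: "bihomogeneous (s_degree k j) (omega_degree k j) (f p)" for p
    using assms(3) by (auto simp: Gamma_space_def Vspace_def bihomogeneous_def)
  have smooth: "smooth_fun_on UNIV (\<lambda>p. coef (f p) e S)" for e S
    using assms(3) unfolding Gamma_space_def by blast
  note diff = smooth_differentiable[OF smooth]
  have rep: "rep k l g F = (\<lambda>p. cst (weight ?h (Suc l) p) * substitute
       (if l \<le> k then act_s_lower (inverse (J1 ?h p)) else act_s_upper (J1 ?h p))
       (act_omega (J2 ?h p)) (F (frac_act ?h p)))" for l F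
    by (rule ext) (simp add: rep_def Let_def weight_def)
  consider "j < k" | "j = k" | "k < j" by linarith
  then show "CF_op k j (rep k j g f) q = rep k (j + 1) g (CF_op k j f) q"
  proof cases
    case 1
    then have "bihomogeneous (k - j) j (f p)" for p
      using f[of p] by (simp add: s_degree_def omega_degree_def)
    from invariance_lower[OF q this diff] 1 show ?thesis
      by (simp add: rep CF_op_def)
  next
    case 2
    have f0: "bihomogeneous 0 k (f p)" for p
      using f[of p] 2 by (simp add: s_degree_def omega_degree_def)
    have df: "bihomogeneous 0 (Suc k) (d_op B' f p)" for B' p
      by (rule bihomogeneous_d_op[OF f0 diff])
    have "bihomogeneous 0 (Suc (Suc k)) (CF_op k k f p)" for p
      unfolding CF_op_def
      by (simp, intro bihomogeneous_cst_mult bihomogeneous_diff bihomogeneous_d_op[OF df]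
          coef_d_op_differentiable[OF f0 smooth])
    note change = substitute_degree_0[OF this, where \<sigma> = "act_s_lower (inverse (J1 ?h q))"
        and \<sigma>' = "act_s_upper (J1 ?h q)"]
    from change[of "act_omega (J2 ?h q)" "frac_act ?h q"] invariance_middle[OF q f0 smooth] 2 show ?thesis
      by (simp add: rep CF_op_def)
  next
    case 3
    then have "bihomogeneous (j - k - 1) (Suc j) (f p)" for p
      using f[of p] by (simp add: s_degree_def omega_degree_def)
    from invariance_upper[OF q this diff] 3 show ?thesis
      by (simp add: rep CF_op_def)
  qed
qed

end
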